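(* The bound $\Theta_{b,\eta,\tau,\theta,\alpha,\gamma}(1/(k+1),g)$ defined in the context, which provides a rate of metastability for the resolvents of continuous pseudocontractive operators in Banach spaces which are uniformly convex and uniformly smooth, is definable in $T_1$ as a functional in the parameters $b,\eta,\tau,\theta,\alpha,\gamma,k,g$.
   Context: **The system $T_1$.** Finite types: $\mathbb N$ is a type, and if $\rho,\sigma$ are types then so is $\rho\to\sigma$ (several arguments are treated by currying). Gödel's system $T$ of primitive recursive functionals of finite type consists of the terms built by application from variables and constants for zero, successor, the basic combinatory operations (equivalently, $\lambda$-abstraction) and recursion over the natural numbers with values in arbitrary finite types. $T_1$ is the fragment of $T$ containing only the recursors $R_0$ and $R_1$, i.e. recursion of type level at most one (values in $\mathbb N$ or in types of level one such as $\mathbb N^{\mathbb N}$). For definability in such a calculus, only natural numbers and functionals thereof may be used: $\varepsilon>0$ is given by a natural number $k$ standing for $\varepsilon=\frac1{k+1}$, and the moduli $\eta,\tau,\theta$ are likewise understood as operating with and returning natural numbers having this interpretation. **What the bound is a rate for.** $\mathbb N=\{0,1,2,\dots\}$, $\mathbb N^*=\{1,2,\dots\}$. Let $X$ be a (real) Banach space with modulus of uniform convexity $\eta:(0,2]\to(0,1]$ (if $\|x\|,\|y\|\le1$, $\|x-y\|\ge s$ then $\|\frac{x+y}2\|\le1-\eta(s)$) and modulus of uniform smoothness $\tau:(0,\infty)\to(0,\infty)$ (if $\|x\|=1$, $\|y\|\le\tau(s)$ then $\|x+y\|+\|x-y\|\le2+s\|y\|$); $C\subseteq X$ closed, convex,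 nonempty; $b\in\mathbb N^*$ a bound on the norms of the elements of $C$ and on the diameter of $C$; $T:C\to C$ a pseudocontraction (i.e. $t\|x-y\|\le\|(t+1)(x-y)-(Tx-Ty)\|$ for all $x,y\in C$, $t>0$) that is uniformly continuous with modulus $\theta:(0,\infty)\to(0,\infty)$ ($\|x-y\|\le\theta(s)$ implies $\|Tx-Ty\|\le s$); $x\in C$; and for $t\in(0,1)$ let $x_t$ be the unique point of $C$ with $x_t=tTx_t+(1-t)x$. Let $(t_n)\subseteq(0,1)$, $\alpha:\mathbb N\to\mathbb N$, $\gamma:\mathbb N\to\mathbb N^*$ be such that $t_m\ge1-\frac1{n+1}$ for all $n$ and $m\ge\alpha(n)$, and $t_n\le1-\frac1{\gamma(n)}$ for all $n$. That $\Theta$ is a rate of metastability means: for all $\varepsilon>0$ and $g:\mathbb N\to\mathbb N$ there is $N\le\Theta_{b,\eta,\tau,\theta,\alpha,\gamma}(\varepsilon,g)$ with $\|x_{t_m}-x_{t_n}\|\le\varepsilon$ for all $m,n\in\{N,N+1,\dots,N+g(N)\}$. **Definition of $\Theta$.** Put $\Theta_{b,\eta,\tau,\theta,\alpha,\gamma}(\varepsilon,g):=\Theta'_{b,\eta,\tau,\theta,\alpha,\gamma}(\frac\varepsilon2,g)$, where $\Theta'_{b,\eta,\tau,\theta,\alpha,\gamma}(\varepsilon,g)$ is defined, for given $\varepsilon>0$ and $g$, as follows. *Real quantities.* For $f:\mathbb N\to\mathbb N$ let $f^M(n):=\max_{0\le i\le n}f(i)$. Let, for $s\in(0,2]$, $$\psi(s):=\min\left(\frac{\left(\min\left(\frac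 s2,\frac{s^2}{72b}\eta^2\left(\frac s{2b}\right)\right)\right)^2}4,\ \frac{s^2}{48}\eta^2\left(\frac s{2b}\right)\right),$$ and, for $s>0$, $$\omega(s):=\frac{\min(s,2)^2}{12\max(b,1)}\,\tau\left(\frac{\min(s,2)}{2\max(b,1)}\right),\qquad \tilde\theta(s):=\min\left(\frac s4,\theta\left(\frac s2\right)\right).$$ Further let $$\nu_4:=\min\left\{\frac{\varepsilon^4}{9216b^2},\ \omega\left(\frac{\varepsilon^2}{96b}\right)^2,\ \frac{\varepsilon^2}{16}\right\},\quad \delta:=\min\left\{\frac{\omega(\nu_4/(3b))}{b},\frac14\right\},\quad p:=\min\left\{\frac{\nu_4}3,\frac{\varepsilon^2}{96}\right\},$$ $$\nu_2:=\frac12\psi\left(\omega\left(\frac p{2b}\right)\right),\quad \beta(c):=\frac p{2b\gamma(c)}\ (c\in\mathbb N),\quad u:=\min\left\{\frac{2\nu_4\delta}3,\nu_2\right\},$$ $$\nu_1^*(m,n):=\frac12\min_{c\le\max(m,\,n+g^M(n))}\psi(\tilde\theta(\beta(c)))\qquad(m,n\in\mathbb N).$$ *Conventions.* $\mathcal O$ denotes a constant zero function. Let $\mathcal F$ be the set of functionals $\mathbb N\times\mathbb N\times\mathbb N^{\mathbb N}\times\mathbb N\to\mathbb N$, and $S:=\mathcal F\times\mathcal F\times\mathbb N\times\mathbb N\times\mathbb N^{\mathbb N}$; elements of $S$ are written $w=(w_1,\dots,w_5)$. $\Omega$ ranges over functions $S\times\mathbb N\to\mathbb N\times\mathbb N\times\mathbb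 N^{\mathbb N}\times\mathbb N\times\mathbb N\times\mathbb N$ with components $\Omega_1,\dots,\Omega_6$. A pair $(G,F)$ always consists of a $G$ with values in $\mathbb N\times\mathbb N\times\mathbb N^{\mathbb N}\times\mathbb N\times\mathbb N$ and an $F$ with values in $\mathbb N$, and is regarded as having 6-tuples as values. $\max$ of functions is pointwise, of tuples componentwise. $U,M$ range over functionals $\mathbb N^{\mathbb N}\times\mathbb N\times\mathbb N\to\mathbb N$. (Below, $k$ is a local variable, not the parameter in $\varepsilon=1/(k+1)$.) *Step 1.* For $k,n\in\mathbb N$: $$W(U,0):=\mathcal O,\quad W(U,n+1):=\lambda y.\,U(W(U,n),y,n),$$ $$J(U,M,k,0):=0,\quad J(U,M,k,n+1):=M\big(W(U,b^2(k+1)),\,J(U,M,k,n),\,b^2(k+1)\big),$$ $$\mathsf N(U,M,k):=W(U,b^2(k+1))\in\mathbb N^{\mathbb N},\qquad \mathsf T(U,M,k):=J(U,M,k,b^2(k+1))\in\mathbb N.$$ *Step 2.* For $l,i\in\mathbb N$ put $I(l):=2b^2(l+1)$ and $$(\mathbf M,\mathbf U)(\Omega,0):=(\mathcal O,\mathcal O),\quad(\mathbf M,\mathbf U)(\Omega,i+1):=\lambda p,y,L,m.\,(\Omega_5,\Omega_6)\big(\mathbf M(\Omega,i),\mathbf U(\Omega,i),p,y,L,m\big),$$ $$(\overline{\mathbf M},\overline{\mathbf U})(l,\Omega):=\lambda L,m,p.\,(\mathbf M,\mathbf U)(\Omega,I(l)+1)(p,b,L,m),$$ $$\widetilde\Psi(l,\Omega,0):=\big(\mathbf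 M(\Omega,I(l)),\ \mathbf U(\Omega,I(l)),\ 4b^2(l+1),\ b,\ \mathsf N(\overline{\mathbf U}(l,\Omega),\overline{\mathbf M}(l,\Omega),4l+3),\ \mathsf T(\overline{\mathbf U}(l,\Omega),\overline{\mathbf M}(l,\Omega),4l+3)\big),$$ $$\widetilde\Psi(l,\Omega,i+1):=\max\Big(\widetilde\Psi(l,\Omega,0),\ \big(\mathbf M(\Omega,I(l)),\mathbf U(\Omega,I(l)),\Omega_1(\widetilde\Psi(l,\Omega,i)),\dots,\Omega_4(\widetilde\Psi(l,\Omega,i))\big)\Big),$$ $$\Psi(l,\Omega):=\widetilde\Psi(l,\Omega,I(l))\in S\times\mathbb N.$$ *Step 3.* For $w,w',v\in S$, $k,k',h,l\in\mathbb N$ and $r=(r_1,r_2,r_3)\in\mathbb N^{\mathbb N}\times\mathbb N\times\mathbb N$: $$U_1(w,k)(r):=\max(r_1(k),w_2(r_3,b,r_1,r_2)),\qquad M_1(w,k)(r):=\max(k,w_1(r_3,b,r_1,r_2)).$$ Abbreviate $\mathsf N_1:=\mathsf N(U_1(w,k),M_1(w,k),\lceil4/u\rceil)$ and $\mathsf T_1:=\mathsf T(U_1(w,k),M_1(w,k),\lceil4/u\rceil)$; then $$(G_0,F_0)(w,k):=\big(b^2(\lceil4/u\rceil+1),\ b,\ \mathsf N_1,\ \mathsf T_1,\ 0,\ \mathsf N_1(k)\big),\qquad\tilde k(w,k):=k+F_0(w,k).$$ With $\nu:=\nu_1^*(\tilde k(w,k),\tilde k(w',k'))$ put $$u'(w,k,w',k'):=\min\left(\frac\nu2,\nu_2\right),\qquad\iota(w,k,w',k'):=\alpha^M\left(\left\lceil\max\left\{\frac{2b}{\sqrt{\nu}},\frac{8b^2}{\nu}\right\}\right\rceil\right).$$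 With $K_2:=\lceil4/u'(w,k,w',k')\rceil$, $\mathsf N_2:=\mathsf N(U_1(v,h),M_1(v,h),K_2)$, $\mathsf T_2:=\mathsf T(U_1(v,h),M_1(v,h),K_2)$ put $$(G_1,F_1)(w,k,w',k',v,h):=\big(b^2(K_2+1),\ b,\ \mathsf N_2,\ \mathsf T_2,\ 0,\ \mathsf N_2(h)\big).$$ Let $$U_2(w,k,v,l)(r):=\max(r_1(k),w_2(r_3,b,r_1,r_2),v_2(r_3,b,r_1,r_2)),$$ $$M_2(w,k,v,l)(r):=\max(k,w_1(r_3,b,r_1,r_2),v_1(r_3,b,r_1,r_2)).$$ With $K_3:=\lceil4/\min(u,u'(w,k,w',k'))\rceil$, $\mathsf N_3:=\mathsf N(U_2(w,k,v,l),M_2(w,k,v,l),K_3)$, $\mathsf T_3:=\mathsf T(U_2(w,k,v,l),M_2(w,k,v,l),K_3)$ put $$(G_2,F_2)(w,k,w',k',v,l):=\big(b^2(K_3+1),\ b,\ \mathsf N_3,\ \mathsf T_3,\ 0,\ \mathsf N_3(l)\big).$$ *Step 4.* For functions $\xi,\xi'$ and a pair $(G,F)$ of functions of $x=(x_1,\dots,x_6)\in(S\times\mathbb N)^3$ (so $x_1,x_3,x_5\in S$ and $x_2,x_4,x_6\in\mathbb N$) put $$\Xi(\xi,\xi')(G,F)(x):=\big(G(x_1,\dots,x_5,x_6+\xi(x)),\ \xi'(x)+F(x_1,\dots,x_5,x_6+\xi(x))\big).$$ Let $\xi_0(x):=x_6$, $\xi_1(x):=\iota(x_1,x_2,x_3,x_4)$,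 $\xi_2(x):=x_2$, $\xi_2'(x):=x_4$, and $$(\tilde G_1,\tilde F_1):=\Xi(\xi_1,\xi_1)(G_1,F_1),\quad(\tilde G_2,\tilde F_2):=\Xi(\xi_2,\xi_2)(G_2,F_2),\quad(\tilde G_3,\tilde F_3):=\Xi(\xi_2,\xi_0)(G_2,F_2),$$ $$(\tilde G_2',\tilde F_2'):=\Xi(\xi_2',\xi_2')(G_2,F_2),\quad(\tilde G_3',\tilde F_3'):=\Xi(\xi_2',\xi_0)(G_2,F_2).$$ *Step 5.* With $q\in(S\times\mathbb N)^3$ in the definitions of $(G_v,F_v)$ and $(G_{v'},F_{v'})$, with $q=(w,k,w',k')\in(S\times\mathbb N)^2$ in that of $(G_{w'},F_{w'})$, with $q\in S\times\mathbb N$ in that of $(G_w,F_w)$, and with $s\in S\times\mathbb N$: $$(G_v,F_v)(q):=\max\big((\tilde G_1,\tilde F_1)(q),(\tilde G_2,\tilde F_2)(q)\big),\quad a_v(r):=\Psi\big(\lceil1/u'(r)\rceil,\ \lambda s.(G_v,F_v)(r,s)\big)\quad(r\in(S\times\mathbb N)^2),$$ $$(G_{v'},F_{v'})(q):=\max\big((\tilde G_1,\tilde F_1)(q),(\tilde G_2',\tilde F_2')(q)\big),\quad a_{v'}(r):=\Psi\big(\lceil1/u'(r)\rceil,\ \lambda s.(G_{v'},F_{v'})(r,s)\big)\quad(r\in(S\times\mathbb N)^2),$$ $$(G_{w'},F_{w'})(q):=\max\big((G_0,F_0)(w',k'),(\tilde G_3',\tilde F_3')(q,a_{v'}(q))\big),\quad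 a_{w'}(r):=\Psi\big(\lceil1/u\rceil,\ \lambda s.(G_{w'},F_{w'})(r,s)\big)\quad(r\in S\times\mathbb N),$$ $$(G_w,F_w)(q):=\max\big((G_0,F_0)(q),(\tilde G_3,\tilde F_3)(q,a_{w'}(q),a_v(q,a_{w'}(q)))\big).$$ Finally, with $(w^\circ,k^\circ):=\Psi(\lceil1/u\rceil,(G_w,F_w))$ and $(w'^\circ,k'^\circ):=a_{w'}(w^\circ,k^\circ)$, put $$\Theta'_{b,\eta,\tau,\theta,\alpha,\gamma}(\varepsilon,g):=k'^\circ+F_0(w'^\circ,k'^\circ).$$ *)

theory Defs
  imports Complex_Main "HOL-Library.Product_Order"
begin

section \<open>Goedel's system T and its fragment \<open>T\<^sub>1\<close>\<close>

datatype ty = TNat | TFun ty ty  (infixr "\<rightarrow>\<^sub>T" 65)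

fun level :: "ty \<Rightarrow> nat" where
  "level TNat = 0"
| "level (\<rho> \<rightarrow>\<^sub>T \<sigma>) = max (level \<rho> + 1) (level \<sigma>)"

text \<open>
  Raw terms. The constants \<open>Fct f\<close> do not belong to system T: they name the number-theoretic
  functions to which a term of T is applied when it is evaluated on function arguments, in the same
  way as the numerals name natural numbers.
\<close>

datatype trm =
    Var nat ty
  | Zero
  | Succ
  | KComb ty ty
  | SComb ty ty ty
  | Rec ty
  | App trm trm  (infixl "\<cdot>" 200)
  | Fct "nat \<Rightarrow> nat"

inductive has_type :: "trm \<Rightarrow> ty \<Rightarrow> bool"  (infix ":\<^sub>T" 50) where
  "Var i \<rho> :\<^sub>T \<rho>"
| "Zero :\<^sub>T TNat"
| "Succ :\<^sub>T TNat \<rightarrow>\<^sub>T TNat"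
| "KComb \<rho> \<sigma> :\<^sub>T \<rho> \<rightarrow>\<^sub>T \<sigma> \<rightarrow>\<^sub>T \<rho>"
| "SComb \<rho> \<sigma> \<tau> :\<^sub>T (\<rho> \<rightarrow>\<^sub>T \<sigma> \<rightarrow>\<^sub>T \<tau>) \<rightarrow>\<^sub>T (\<rho> \<rightarrow>\<^sub>T \<sigma>) \<rightarrow>\<^sub>T \<rho> \<rightarrow>\<^sub>T \<tau>"
| "Rec \<rho> :\<^sub>T \<rho> \<rightarrow>\<^sub>T (TNat \<rightarrow>\<^sub>T \<rho> \<rightarrow>\<^sub>T \<rho>) \<rightarrow>\<^sub>T TNat \<rightarrow>\<^sub>T \<rho>"
| "Fct f :\<^sub>T TNat \<rightarrow>\<^sub>T TNat"
| "s :\<^sub>T \<rho> \<rightarrow>\<^sub>T \<sigma> \<Longrightarrow> t :\<^sub>T \<rho> \<Longrightarrow> s \<cdot> t :\<^sub>T \<sigma>"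

fun in_T1 :: "trm \<Rightarrow> bool" where
  "in_T1 (Rec \<rho>) \<longleftrightarrow> level \<rho> \<le> 1"
| "in_T1 (s \<cdot> t) \<longleftrightarrow> in_T1 s \<and> in_T1 t"
| "in_T1 (Fct f) \<longleftrightarrow> False"
| "in_T1 _ \<longleftrightarrow> True"

fun closed_trm :: "trm \<Rightarrow> bool" where
  "closed_trm (Var i \<rho>) \<longleftrightarrow> False"
| "closed_trm (s \<cdot> t) \<longleftrightarrow> closed_trm s \<and> closed_trm t"
| "closed_trm _ \<longleftrightarrow> True"

primrec numeral_trm :: "nat \<Rightarrow> trm" where
  "numeral_trm 0 = Zero"
| "numeral_trm (Suc n) = Succ \<cdot> numeral_trm n"

inductive red :: "trm \<Rightarrow> trm \<Rightarrow> bool"  (infix "\<leadsto>" 50) where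
  red_K: "KComb \<rho> \<sigma> \<cdot> x \<cdot> y \<leadsto> x"
| red_S: "SComb \<rho> \<sigma> \<tau> \<cdot> x \<cdot> y \<cdot> z \<leadsto> x \<cdot> z \<cdot> (y \<cdot> z)"
| red_Rec_Zero: "Rec \<rho> \<cdot> x \<cdot> y \<cdot> Zero \<leadsto> x"
| red_Rec_Succ: "Rec \<rho> \<cdot> x \<cdot> y \<cdot> (Succ \<cdot> n) \<leadsto> y \<cdot> n \<cdot> (Rec \<rho> \<cdot> x \<cdot> y \<cdot> n)"
| red_Fct: "Fct f \<cdot> numeral_trm n \<leadsto> numeral_trm (f n)"
| red_AppL: "s \<leadsto> s' \<Longrightarrow> s \<cdot> t \<leadsto> s' \<cdot> t"
| red_AppR: "t \<leadsto> t' \<Longrightarrow> s \<cdot> t \<leadsto> s \<cdot> t'"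

text \<open>
  A closed term of type \<open>TNat\<close> has the value \<open>n\<close> if it reduces to the numeral of \<open>n\<close>. The value
  is unique (lemma \<open>evaluates_to_unique\<close> below) and, as each reduction rule is valid in the full
  set-theoretic type structure over the natural numbers, it agrees with the value there. That
  structure itself is not available inside HOL, since there is no HOL type that contains all
  finite types over \<open>nat\<close>.
\<close>

definition evaluates_to :: "trm \<Rightarrow> nat \<Rightarrow> bool"  (infix "\<Down>" 50) where
  "t \<Down> n \<longleftrightarrow> red\<^sup>*\<^sup>* t (numeral_trm n)"

subsection \<open>Uniqueness of values\<close>

text \<open>Parallel reduction, for the Tait--Martin-Loef confluence argument.\<close>

inductive par_red :: "trm \<Rightarrow> trm \<Rightarrow> bool" where
  pr_refl: "par_red t t"
| pr_App: "par_red s s' \<Longrightarrow> par_red t t' \<Longrightarrow> par_red (s \<cdot> t) (s' \<cdot> t')"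
| pr_K: "par_red x x' \<Longrightarrow> par_red (KComb \<rho> \<sigma> \<cdot> x \<cdot> y) x'"
| pr_S: "par_red x x' \<Longrightarrow> par_red y y' \<Longrightarrow> par_red z z' \<Longrightarrow>
    par_red (SComb \<rho> \<sigma> \<tau> \<cdot> x \<cdot> y \<cdot> z) (x' \<cdot> z' \<cdot> (y' \<cdot> z'))"
| pr_RZ: "par_red x x' \<Longrightarrow> par_red (Rec \<rho> \<cdot> x \<cdot> y \<cdot> Zero) x'"
| pr_RS: "par_red x x' \<Longrightarrow> par_red y y' \<Longrightarrow> par_red n n' \<Longrightarrow>
    par_red (Rec \<rho> \<cdot> x \<cdot> y \<cdot> (Succ \<cdot> n)) (y' \<cdot> n' \<cdot> (Rec \<rho> \<cdot> x' \<cdot> y' \<cdot> n'))"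
| pr_F: "par_red (Fct f \<cdot> numeral_trm n) (numeral_trm (f n))"

inductive_cases par_red_atomE:
  "par_red Zero t" "par_red Succ t" "par_red (KComb \<rho> \<sigma>) t" "par_red (SComb \<rho> \<sigma> \<tau>) t" "par_red (Rec \<rho>) t"
  "par_red (Fct f) t" 
inductive_cases par_red_p1E:
  "par_red (Succ \<cdot> x) t" "par_red (KComb \<rho> \<sigma> \<cdot> x) t" "par_red (SComb \<rho> \<sigma> \<tau> \<cdot> x) t" "par_red (Rec \<rho> \<cdot> x) t"
inductive_cases par_red_p2E:
  "par_red (SComb \<rho> \<sigma> \<tau> \<cdot> x \<cdot> y) t" "par_red (Rec \<rho> \<cdot> x \<cdot> y) t"

lemma par_red_numeral: "par_red (numeral_trm n) t \<Longrightarrow> t = numeral_trm n"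
  by (induction n arbitrary: t) (auto elim: par_red_atomE par_red_p1E)

lemma par_red_K1: "par_red (KComb \<rho> \<sigma> \<cdot> x) t \<Longrightarrow> \<exists>x'. t = KComb \<rho> \<sigma> \<cdot> x' \<and> par_red x x'"
  by (auto elim: par_red_atomE par_red_p1E intro: pr_refl)

lemma par_red_S2: "par_red (SComb \<rho> \<sigma> \<tau> \<cdot> x \<cdot> y) t \<Longrightarrow>
    \<exists>x' y'. t = SComb \<rho> \<sigma> \<tau> \<cdot> x' \<cdot> y' \<and> par_red x x' \<and> par_red y y'"
  by (auto elim!: par_red_atomE par_red_p1E par_red_p2E intro: pr_refl)

lemma par_red_R2: "par_red (Rec \<rho> \<cdot> x \<cdot> y) t \<Longrightarrow>
    \<exists>x' y'. t = Rec \<rho> \<cdot> x' \<cdot> y' \<and> par_red x x' \<and> par_red y y'"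
  by (auto elim!: par_red_atomE par_red_p1E par_red_p2E intro: pr_refl)

lemma par_red_Succ1: "par_red (Succ \<cdot> x) t \<Longrightarrow> \<exists>x'. t = Succ \<cdot> x' \<and> par_red x x'"
  by (auto elim: par_red_atomE par_red_p1E intro: pr_refl)

lemma numeral_trm_inject: "numeral_trm m = numeral_trm n \<Longrightarrow> m = n"
proof (induction m arbitrary: n)
  case 0 then show ?case by (cases n) auto
next
  case (Suc m) then show ?case by (cases n) auto
qed

lemma par_red_App_cases:
  assumes "par_red (s \<cdot> t) r"
  obtains s' t' where "r = s' \<cdot> t'" "par_red s s'" "par_red t t'"
  | \<rho> \<sigma> x where "s = KComb \<rho> \<sigma> \<cdot> x" "par_red x r"
  | \<rho> \<sigma> \<tau> x y x' y' t' where "s = SComb \<rho> \<sigma> \<tau> \<cdot> x \<cdot> y" "r = x' \<cdot> t' \<cdot> (y' \<cdot> t')"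
      "par_red x x'" "par_red y y'" "par_red t t'"
  | \<rho> x y where "s = Rec \<rho> \<cdot> x \<cdot> y" "t = Zero" "par_red x r"
  | \<rho> x y n x' y' n' where "s = Rec \<rho> \<cdot> x \<cdot> y" "t = Succ \<cdot> n"
      "r = y' \<cdot> n' \<cdot> (Rec \<rho> \<cdot> x' \<cdot> y' \<cdot> n')" "par_red x x'" "par_red y y'" "par_red n n'"
  | f n where "s = Fct f" "t = numeral_trm n" "r = numeral_trm (f n)"
  using assms by (cases rule: par_red.cases) (auto intro: pr_refl)

lemma par_red_diamond: "par_red t a \<Longrightarrow> par_red t b \<Longrightarrow> \<exists>c. par_red a c \<and> par_red b c"
proof (induction arbitrary: b rule: par_red.induct)
  case (pr_refl t)
  then show ?case by (blast intro: par_red.pr_refl)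
next
  case (pr_App s s' t t')
  from pr_App.prems show ?case
  proof (cases rule: par_red_App_cases)
    case (1 s2 t2)
    with pr_App.IH show ?thesis by (meson par_red.pr_App)
  next
    case (2 \<rho> \<sigma> x)
    from 2 pr_App.hyps obtain x1 where x1: "s' = KComb \<rho> \<sigma> \<cdot> x1" by (meson par_red_K1)
    have "par_red s (KComb \<rho> \<sigma> \<cdot> b)" using 2 by (auto intro: par_red.intros)
    with pr_App.IH(1) obtain c where c: "par_red s' c" "par_red (KComb \<rho> \<sigma> \<cdot> b) c" by blast
    then obtain c' where "c = KComb \<rho> \<sigma> \<cdot> c'" "par_red b c'" by (meson par_red_K1)
    with c x1 have "par_red x1 c'" by (auto dest!: par_red_K1)
    with x1 \<open>par_red b c'\<close> show ?thesis by (blast intro: pr_K)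
  next
    case (3 \<rho> \<sigma> \<tau> x y x2 y2 t2)
    from 3 pr_App.hyps obtain x1 y1 where x1: "s' = SComb \<rho> \<sigma> \<tau> \<cdot> x1 \<cdot> y1" by (meson par_red_S2)
    have "par_red s (SComb \<rho> \<sigma> \<tau> \<cdot> x2 \<cdot> y2)" using 3 by (auto intro: par_red.intros)
    with pr_App.IH(1) obtain c where c: "par_red s' c" "par_red (SComb \<rho> \<sigma> \<tau> \<cdot> x2 \<cdot> y2) c" by blast
    then obtain cx cy where cc: "c = SComb \<rho> \<sigma> \<tau> \<cdot> cx \<cdot> cy" "par_red x2 cx" "par_red y2 cy"
      by (meson par_red_S2)
    with c x1 have "par_red x1 cx" "par_red y1 cy" by (auto dest!: par_red_S2)
    moreover from pr_App.IH(2) 3 obtain ct where "par_red t' ct" "par_red t2 ct" by blast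
    ultimately show ?thesis using x1 cc 3(2) by (blast intro: pr_S par_red.pr_App)
  next
    case (4 \<rho> x y)
    from 4 pr_App.hyps obtain x1 y1 where x1: "s' = Rec \<rho> \<cdot> x1 \<cdot> y1" by (meson par_red_R2)
    have t': "t' = Zero" using 4 pr_App.hyps by (auto elim: par_red_atomE)
    have "par_red s (Rec \<rho> \<cdot> b \<cdot> y)" using 4 by (auto intro: par_red.intros)
    with pr_App.IH(1) obtain c where c: "par_red s' c" "par_red (Rec \<rho> \<cdot> b \<cdot> y) c" by blast
    then obtain cx cy where cc: "c = Rec \<rho> \<cdot> cx \<cdot> cy" "par_red b cx" by (meson par_red_R2)
    with c x1 have "par_red x1 cx" by (auto dest!: par_red_R2)
    then show ?thesis using x1 cc t' by (blast intro: pr_RZ)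
  next
    case (5 \<rho> x y n x2 y2 n2)
    from 5 pr_App.hyps obtain x1 y1 where x1: "s' = Rec \<rho> \<cdot> x1 \<cdot> y1" by (meson par_red_R2)
    from 5 pr_App.hyps obtain n1 where n1: "t' = Succ \<cdot> n1" by (meson par_red_Succ1)
    have "par_red s (Rec \<rho> \<cdot> x2 \<cdot> y2)" using 5 by (auto intro: par_red.intros)
    with pr_App.IH(1) obtain c where c: "par_red s' c" "par_red (Rec \<rho> \<cdot> x2 \<cdot> y2) c" by blast
    then obtain cx cy where cc: "c = Rec \<rho> \<cdot> cx \<cdot> cy" "par_red x2 cx" "par_red y2 cy" by (meson par_red_R2)
    with c x1 have xy: "par_red x1 cx" "par_red y1 cy" by (auto dest!: par_red_R2)
    have "par_red t (Succ \<cdot> n2)" using 5 by (auto intro: par_red.intros)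
    with pr_App.IH(2) obtain d where d: "par_red t' d" "par_red (Succ \<cdot> n2) d" by blast
    then obtain cn where "d = Succ \<cdot> cn" "par_red n2 cn" by (meson par_red_Succ1)
    moreover from this d n1 have "par_red n1 cn" by (auto dest!: par_red_Succ1)
    ultimately have "par_red (s' \<cdot> t') (cy \<cdot> cn \<cdot> (Rec \<rho> \<cdot> cx \<cdot> cy \<cdot> cn))"
      "par_red b (cy \<cdot> cn \<cdot> (Rec \<rho> \<cdot> cx \<cdot> cy \<cdot> cn))"
      using x1 n1 cc xy 5(3) by (simp_all add: pr_RS par_red.pr_App pr_refl)
    then show ?thesis by blast
  next
    case (6 f n)
    with pr_App.hyps have "s' = Fct f" "t' = numeral_trm n"
      by (auto elim: par_red_atomE dest: par_red_numeral)
    with 6 show ?thesis by (blast intro: par_red.pr_refl pr_F)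
  qed
next
  case (pr_K x x' \<rho> \<sigma> y)
  from pr_K.prems show ?case
  proof (cases rule: par_red_App_cases)
    case (1 s2 t2)
    then obtain x2 where "s2 = KComb \<rho> \<sigma> \<cdot> x2" "par_red x x2" by (meson par_red_K1)
    with 1 pr_K.IH show ?thesis by (blast intro: par_red.pr_K)
  qed (use pr_K.IH in auto)
next
  case (pr_S x x' y y' z z' \<rho> \<sigma> \<tau>)
  from pr_S.prems show ?case
  proof (cases rule: par_red_App_cases)
    case (1 s2 t2)
    then obtain x2 y2 where "s2 = SComb \<rho> \<sigma> \<tau> \<cdot> x2 \<cdot> y2" "par_red x x2" "par_red y y2"
      by (meson par_red_S2)
    moreover from calculation pr_S.IH 1 obtain cx cy cz where
      "par_red x' cx" "par_red x2 cx" "par_red y' cy" "par_red y2 cy" "par_red z' cz" "par_red t2 cz" by meson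
    ultimately show ?thesis using 1 by (blast intro: par_red.pr_S par_red.pr_App)
  next
    case (3 \<rho>' \<sigma>' \<tau>' x1 y1 x2 y2 t2)
    then have "par_red x x2" "par_red y y2" by auto
    with pr_S.IH 3 obtain cx cy cz where
      "par_red x' cx" "par_red x2 cx" "par_red y' cy" "par_red y2 cy" "par_red z' cz" "par_red t2 cz"
      by meson
    with 3 show ?thesis by (blast intro: par_red.pr_App)
  qed auto
next
  case (pr_RZ x x' \<rho> y)
  from pr_RZ.prems show ?case
  proof (cases rule: par_red_App_cases)
    case (1 s2 t2)
    then obtain x2 y2 where "s2 = Rec \<rho> \<cdot> x2 \<cdot> y2" "par_red x x2" by (meson par_red_R2)
    moreover have "t2 = Zero" using 1 by (auto elim: par_red_atomE)
    ultimately show ?thesis using 1 pr_RZ.IH by (blast intro: par_red.pr_RZ)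
  qed (use pr_RZ.IH in auto)
next
  case (pr_RS x x' y y' n n' \<rho>)
  have *: "\<exists>cx cy cn. par_red x' cx \<and> par_red x2 cx \<and> par_red y' cy \<and> par_red y2 cy \<and> par_red n' cn \<and> par_red n2 cn"
    if "par_red x x2" "par_red y y2" "par_red n n2" for x2 y2 n2
    using pr_RS.IH that by meson
  from pr_RS.prems show ?case
  proof (cases rule: par_red_App_cases)
    case (1 s2 t2)
    then obtain x2 y2 n2 where s2: "s2 = Rec \<rho> \<cdot> x2 \<cdot> y2" "par_red x x2" "par_red y y2" "t2 = Succ \<cdot> n2"
      "par_red n n2" by (meson par_red_R2 par_red_Succ1)
    with * obtain cx cy cn where "par_red x' cx" "par_red x2 cx" "par_red y' cy" "par_red y2 cy"
      "par_red n' cn" "par_red n2 cn" by meson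
    with 1 s2 have "par_red (y' \<cdot> n' \<cdot> (Rec \<rho> \<cdot> x' \<cdot> y' \<cdot> n')) (cy \<cdot> cn \<cdot> (Rec \<rho> \<cdot> cx \<cdot> cy \<cdot> cn))"
      "par_red b (cy \<cdot> cn \<cdot> (Rec \<rho> \<cdot> cx \<cdot> cy \<cdot> cn))"
      by (simp_all add: par_red.pr_RS pr_App pr_refl)
    then show ?thesis by blast
  next
    case (5 \<rho>' x1 y1 n1 x2 y2 n2)
    then have "par_red x x2" "par_red y y2" "par_red n n2" by auto
    with * obtain cx cy cn where "par_red x' cx" "par_red x2 cx" "par_red y' cy" "par_red y2 cy"
      "par_red n' cn" "par_red n2 cn" by meson
    with 5 have "par_red (y' \<cdot> n' \<cdot> (Rec \<rho> \<cdot> x' \<cdot> y' \<cdot> n')) (cy \<cdot> cn \<cdot> (Rec \<rho> \<cdot> cx \<cdot> cy \<cdot> cn))"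
      "par_red b (cy \<cdot> cn \<cdot> (Rec \<rho> \<cdot> cx \<cdot> cy \<cdot> cn))"
      by (simp_all add: pr_App pr_refl)
    then show ?thesis by blast
  qed auto
next
  case (pr_F f n)
  from pr_F.prems show ?case
  proof (cases rule: par_red_App_cases)
    case (1 s2 t2)
    then have "s2 = Fct f" "t2 = numeral_trm n" by (auto elim: par_red_atomE dest: par_red_numeral)
    with 1 show ?thesis by (blast intro: par_red.pr_refl par_red.pr_F)
  qed (auto dest: numeral_trm_inject intro: par_red.pr_refl)
qed

lemma red_imp_par_red: "s \<leadsto> t \<Longrightarrow> par_red s t"
  by (induction rule: red.induct) (auto intro: par_red.intros)

lemma par_red_strip: "par_red\<^sup>*\<^sup>* t a \<Longrightarrow> par_red t b \<Longrightarrow> \<exists>c. par_red a c \<and> par_red\<^sup>*\<^sup>* b c"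
proof (induction rule: rtranclp_induct)
  case (step a a')
  then show ?case by (meson par_red_diamond rtranclp.rtrancl_into_rtrancl)
qed auto

lemma par_red_rtranclp_numeral: "par_red\<^sup>*\<^sup>* (numeral_trm n) t \<Longrightarrow> t = numeral_trm n"
  by (induction rule: rtranclp_induct) (auto dest: par_red_numeral)

lemma evaluates_to_unique:
  assumes "t \<Down> m" and "t \<Down> n"
  shows "m = n"
proof -
  have *: "par_red\<^sup>*\<^sup>* t (numeral_trm k)" if "t \<Down> k" for k
    using that unfolding evaluates_to_def by (rule rtranclp_mono[THEN predicate2D, rotated])
      (auto intro: red_imp_par_red)
  have "par_red\<^sup>*\<^sup>* a (numeral_trm n)" if "par_red\<^sup>*\<^sup>* t a" for a
    using that
  proof (induction rule: rtranclp_induct)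
    case base
    then show ?case using * assms by blast
  next
    case (step a a')
    then obtain c where "par_red (numeral_trm n) c" "par_red\<^sup>*\<^sup>* a' c" using par_red_strip by meson
    then show ?case using par_red_numeral by blast
  qed
  from this[OF *[OF assms(1)]] show ?thesis
    using par_red_rtranclp_numeral numeral_trm_inject by metis
qed


section \<open>The bound\<close>

text \<open>
  A 5-tuple followed by a natural number is written \<open>((w\<^sub>1, \<dots>, w\<^sub>5), k)\<close>. The lattice operation
  \<open>sup\<close> is the maximum on \<^typ>\<open>nat\<close>; on functions it is pointwise and on products it is
  componentwise.
\<close>

type_synonym functional = "nat \<Rightarrow> nat \<Rightarrow> (nat \<Rightarrow> nat) \<Rightarrow> nat \<Rightarrow> nat"
type_synonym S = "functional \<times> functional \<times> nat \<times> nat \<times> (nat \<Rightarrow> nat)"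
type_synonym SN = "S \<times> nat"
type_synonym six = "nat \<times> nat \<times> (nat \<Rightarrow> nat) \<times> nat \<times> nat \<times> nat"

definition running_max :: "(nat \<Rightarrow> nat) \<Rightarrow> nat \<Rightarrow> nat" where
  "running_max f n = Max (f ` {..n})"

abbreviation six5 :: "six \<Rightarrow> nat" where
  "six5 x \<equiv> (case x of (_, _, _, _, x5, _) \<Rightarrow> x5)"

abbreviation six6 :: "six \<Rightarrow> nat" where
  "six6 x \<equiv> (case x of (_, _, _, _, _, x6) \<Rightarrow> x6)"

primrec W :: "((nat \<Rightarrow> nat) \<Rightarrow> nat \<Rightarrow> nat \<Rightarrow> nat) \<Rightarrow> nat \<Rightarrow> nat \<Rightarrow> nat" where
  "W U 0 = (\<lambda>_. 0)"
| "W U (Suc n) = (\<lambda>y. U (W U n) y n)"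

primrec MU :: "(SN \<Rightarrow> six) \<Rightarrow> nat \<Rightarrow> functional \<times> functional" where
  "MU \<Omega> 0 = ((\<lambda>_ _ _ _. 0), (\<lambda>_ _ _ _. 0))"
| "MU \<Omega> (Suc i) =
    ((\<lambda>p y L m. six5 (\<Omega> ((fst (MU \<Omega> i), snd (MU \<Omega> i), p, y, L), m))),
     (\<lambda>p y L m. six6 (\<Omega> ((fst (MU \<Omega> i), snd (MU \<Omega> i), p, y, L), m))))"

definition Xi :: "(SN \<times> SN \<times> SN \<Rightarrow> nat) \<Rightarrow> (SN \<times> SN \<times> SN \<Rightarrow> nat) \<Rightarrow>
    (SN \<times> SN \<times> SN \<Rightarrow> six) \<Rightarrow> SN \<times> SN \<times> SN \<Rightarrow> six" where
  "Xi \<xi> \<xi>' GF = (\<lambda>(x12, x34, (x5, x6)).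
     let x = (x12, x34, (x5, x6)); (g1, g2, g3, g4, g5, f) = GF (x12, x34, (x5, x6 + \<xi> x))
     in (g1, g2, g3, g4, g5, \<xi>' x + f))"

locale metastability_bound =
  fixes b :: nat
    and \<eta> \<tau> \<theta> :: "real \<Rightarrow> real"
    and \<alpha> \<gamma> :: "nat \<Rightarrow> nat"
    and \<epsilon> :: real
    and g :: "nat \<Rightarrow> nat"
begin

subsection \<open>Real quantities\<close>

definition \<psi> :: "real \<Rightarrow> real" where
  "\<psi> s = min ((min (s / 2) (s\<^sup>2 / (72 * b) * (\<eta> (s / (2 * b)))\<^sup>2))\<^sup>2 / 4)
             (s\<^sup>2 / 48 * (\<eta> (s / (2 * b)))\<^sup>2)"

definition \<omega> :: "real \<Rightarrow> real" where
  "\<omega> s = (min s 2)\<^sup>2 / (12 * max (real b) 1) * \<tau> (min s 2 / (2 * max (real b) 1))"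

definition \<theta>' :: "real \<Rightarrow> real" where
  "\<theta>' s = min (s / 4) (\<theta> (s / 2))"

definition \<nu>4 :: real where
  "\<nu>4 = min (\<epsilon> ^ 4 / (9216 * (real b)\<^sup>2)) (min ((\<omega> (\<epsilon>\<^sup>2 / (96 * b)))\<^sup>2) (\<epsilon>\<^sup>2 / 16))"

definition \<delta> :: real where
  "\<delta> = min (\<omega> (\<nu>4 / (3 * b)) / b) (1 / 4)"

definition pe :: real where
  "pe = min (\<nu>4 / 3) (\<epsilon>\<^sup>2 / 96)"

definition \<nu>2 :: real where
  "\<nu>2 = 1 / 2 * \<psi> (\<omega> (pe / (2 * b)))"

definition \<beta> :: "nat \<Rightarrow> real" where
  "\<beta> c = pe / (2 * b * \<gamma> c)"

definition u :: real where
  "u = min (2 * \<nu>4 * \<delta> / 3) \<nu>2"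

definition \<nu>1 :: "nat \<Rightarrow> nat \<Rightarrow> real" where
  "\<nu>1 m n = 1 / 2 * Min ((\<lambda>c. \<psi> (\<theta>' (\<beta> c))) ` {..max m (n + running_max g n)})"

subsection \<open>Solution functionals\<close>

primrec J :: "((nat \<Rightarrow> nat) \<Rightarrow> nat \<Rightarrow> nat \<Rightarrow> nat) \<Rightarrow> ((nat \<Rightarrow> nat) \<Rightarrow> nat \<Rightarrow> nat \<Rightarrow> nat) \<Rightarrow>
    nat \<Rightarrow> nat \<Rightarrow> nat" where
  "J U M k 0 = 0"
| "J U M k (Suc n) = M (W U (b\<^sup>2 * (k + 1))) (J U M k n) (b\<^sup>2 * (k + 1))"

definition NN :: "((nat \<Rightarrow> nat) \<Rightarrow> nat \<Rightarrow> nat \<Rightarrow> nat) \<Rightarrow> ((nat \<Rightarrow> nat) \<Rightarrow> nat \<Rightarrow> nat \<Rightarrow> nat) \<Rightarrow>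
    nat \<Rightarrow> nat \<Rightarrow> nat" where
  "NN U M k = W U (b\<^sup>2 * (k + 1))"

definition TT :: "((nat \<Rightarrow> nat) \<Rightarrow> nat \<Rightarrow> nat \<Rightarrow> nat) \<Rightarrow> ((nat \<Rightarrow> nat) \<Rightarrow> nat \<Rightarrow> nat \<Rightarrow> nat) \<Rightarrow>
    nat \<Rightarrow> nat" where
  "TT U M k = J U M k (b\<^sup>2 * (k + 1))"

definition I :: "nat \<Rightarrow> nat" where
  "I l = 2 * b\<^sup>2 * (l + 1)"

definition Mbar :: "nat \<Rightarrow> (SN \<Rightarrow> six) \<Rightarrow> (nat \<Rightarrow> nat) \<Rightarrow> nat \<Rightarrow> nat \<Rightarrow> nat" where
  "Mbar l \<Omega> = (\<lambda>L m p. fst (MU \<Omega> (I l + 1)) p b L m)"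

definition Ubar :: "nat \<Rightarrow> (SN \<Rightarrow> six) \<Rightarrow> (nat \<Rightarrow> nat) \<Rightarrow> nat \<Rightarrow> nat \<Rightarrow> nat" where
  "Ubar l \<Omega> = (\<lambda>L m p. snd (MU \<Omega> (I l + 1)) p b L m)"

definition \<Psi>0 :: "nat \<Rightarrow> (SN \<Rightarrow> six) \<Rightarrow> SN" where
  "\<Psi>0 l \<Omega> =
    ((fst (MU \<Omega> (I l)), snd (MU \<Omega> (I l)), 4 * b\<^sup>2 * (l + 1), b,
      NN (Ubar l \<Omega>) (Mbar l \<Omega>) (4 * l + 3)),
     TT (Ubar l \<Omega>) (Mbar l \<Omega>) (4 * l + 3))"

primrec \<Psi>iter :: "nat \<Rightarrow> (SN \<Rightarrow> six) \<Rightarrow> nat \<Rightarrow> SN" where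
  "\<Psi>iter l \<Omega> 0 = \<Psi>0 l \<Omega>"
| "\<Psi>iter l \<Omega> (Suc i) = sup (\<Psi>0 l \<Omega>)
    (case \<Omega> (\<Psi>iter l \<Omega> i) of (o1, o2, o3, o4, _, _) \<Rightarrow>
      ((fst (MU \<Omega> (I l)), snd (MU \<Omega> (I l)), o1, o2, o3), o4))"

definition \<Psi> :: "nat \<Rightarrow> (SN \<Rightarrow> six) \<Rightarrow> SN" where
  "\<Psi> l \<Omega> = \<Psi>iter l \<Omega> (I l)"

subsection \<open>Counterfunctions\<close>

text \<open>
  The functionals \<open>U\<^sub>1, M\<^sub>1, U\<^sub>2, M\<^sub>2\<close> are curried in their argument \<open>r = (r\<^sub>1, r\<^sub>2, r\<^sub>3)\<close>. A pair
  \<open>(G, F)\<close> is one function with values in 6-tuples whose last component is the value of \<open>F\<close>.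
\<close>

definition U1 :: "S \<Rightarrow> nat \<Rightarrow> (nat \<Rightarrow> nat) \<Rightarrow> nat \<Rightarrow> nat \<Rightarrow> nat" where
  "U1 = (\<lambda>(w1, w2, _, _, _) k r1 r2 r3. max (r1 k) (w2 r3 b r1 r2))"

definition M1 :: "S \<Rightarrow> nat \<Rightarrow> (nat \<Rightarrow> nat) \<Rightarrow> nat \<Rightarrow> nat \<Rightarrow> nat" where
  "M1 = (\<lambda>(w1, w2, _, _, _) k r1 r2 r3. max k (w1 r3 b r1 r2))"

definition U2 :: "S \<Rightarrow> nat \<Rightarrow> S \<Rightarrow> nat \<Rightarrow> (nat \<Rightarrow> nat) \<Rightarrow> nat \<Rightarrow> nat \<Rightarrow> nat" where
  "U2 = (\<lambda>(w1, w2, _, _, _) k (v1, v2, _, _, _) l r1 r2 r3.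
     max (r1 k) (max (w2 r3 b r1 r2) (v2 r3 b r1 r2)))"

definition M2 :: "S \<Rightarrow> nat \<Rightarrow> S \<Rightarrow> nat \<Rightarrow> (nat \<Rightarrow> nat) \<Rightarrow> nat \<Rightarrow> nat \<Rightarrow> nat" where
  "M2 = (\<lambda>(w1, w2, _, _, _) k (v1, v2, _, _, _) l r1 r2 r3.
     max k (max (w1 r3 b r1 r2) (v1 r3 b r1 r2)))"

definition GF0 :: "SN \<Rightarrow> six" where
  "GF0 = (\<lambda>(w, k). let K = nat \<lceil>4 / u\<rceil>; N = NN (U1 w k) (M1 w k) K; T = TT (U1 w k) (M1 w k) K
     in (b\<^sup>2 * (K + 1), b, N, T, 0, N k))"

definition ktilde :: "SN \<Rightarrow> nat" where
  "ktilde = (\<lambda>(w, k). k + six6 (GF0 (w, k)))"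

definition \<nu> :: "SN \<times> SN \<Rightarrow> real" where
  "\<nu> = (\<lambda>(wk, wk'). \<nu>1 (ktilde wk) (ktilde wk'))"

definition u' :: "SN \<times> SN \<Rightarrow> real" where
  "u' q = min (\<nu> q / 2) \<nu>2"

definition \<iota> :: "SN \<times> SN \<Rightarrow> nat" where
  "\<iota> q = running_max \<alpha> (nat \<lceil>max (2 * b / sqrt (\<nu> q)) (8 * (real b)\<^sup>2 / \<nu> q)\<rceil>)"

definition GF1 :: "SN \<times> SN \<times> SN \<Rightarrow> six" where
  "GF1 = (\<lambda>(wk, wk', (v, h)).
     let K = nat \<lceil>4 / u' (wk, wk')\<rceil>; N = NN (U1 v h) (M1 v h) K; T = TT (U1 v h) (M1 v h) K
     in (b\<^sup>2 * (K + 1), b, N, T, 0, N h))"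

definition GF2 :: "SN \<times> SN \<times> SN \<Rightarrow> six" where
  "GF2 = (\<lambda>((w, k), wk', (v, l)).
     let K = nat \<lceil>4 / min u (u' ((w, k), wk'))\<rceil>;
         N = NN (U2 w k v l) (M2 w k v l) K; T = TT (U2 w k v l) (M2 w k v l) K
     in (b\<^sup>2 * (K + 1), b, N, T, 0, N l))"

definition \<xi>0 :: "SN \<times> SN \<times> SN \<Rightarrow> nat" where
  "\<xi>0 = (\<lambda>((x1, x2), (x3, x4), (x5, x6)). x6)"

definition \<xi>1 :: "SN \<times> SN \<times> SN \<Rightarrow> nat" where
  "\<xi>1 = (\<lambda>(x12, x34, x56). \<iota> (x12, x34))"

definition \<xi>2 :: "SN \<times> SN \<times> SN \<Rightarrow> nat" where
  "\<xi>2 = (\<lambda>((x1, x2), (x3, x4), (x5, x6)). x2)"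

definition \<xi>2' :: "SN \<times> SN \<times> SN \<Rightarrow> nat" where
  "\<xi>2' = (\<lambda>((x1, x2), (x3, x4), (x5, x6)). x4)"

definition GFv :: "SN \<times> SN \<times> SN \<Rightarrow> six" where
  "GFv q = sup (Xi \<xi>1 \<xi>1 GF1 q) (Xi \<xi>2 \<xi>2 GF2 q)"

definition av :: "SN \<times> SN \<Rightarrow> SN" where
  "av = (\<lambda>(r1, r2). \<Psi> (nat \<lceil>1 / u' (r1, r2)\<rceil>) (\<lambda>s. GFv (r1, r2, s)))"

definition GFv' :: "SN \<times> SN \<times> SN \<Rightarrow> six" where
  "GFv' q = sup (Xi \<xi>1 \<xi>1 GF1 q) (Xi \<xi>2' \<xi>2' GF2 q)"

definition av' :: "SN \<times> SN \<Rightarrow> SN" where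
  "av' = (\<lambda>(r1, r2). \<Psi> (nat \<lceil>1 / u' (r1, r2)\<rceil>) (\<lambda>s. GFv' (r1, r2, s)))"

definition GFw' :: "SN \<times> SN \<Rightarrow> six" where
  "GFw' = (\<lambda>(wk, wk'). sup (GF0 wk') (Xi \<xi>2' \<xi>0 GF2 (wk, wk', av' (wk, wk'))))"

definition aw' :: "SN \<Rightarrow> SN" where
  "aw' r = \<Psi> (nat \<lceil>1 / u\<rceil>) (\<lambda>s. GFw' (r, s))"

definition GFw :: "SN \<Rightarrow> six" where
  "GFw q = sup (GF0 q) (Xi \<xi>2 \<xi>0 GF2 (q, aw' q, av (q, aw' q)))"

definition \<Theta>' :: nat where
  "\<Theta>' = ktilde (aw' (\<Psi> (nat \<lceil>1 / u\<rceil>) GFw))"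

end

definition \<Theta> :: "nat \<Rightarrow> (real \<Rightarrow> real) \<Rightarrow> (real \<Rightarrow> real) \<Rightarrow> (real \<Rightarrow> real) \<Rightarrow>
    (nat \<Rightarrow> nat) \<Rightarrow> (nat \<Rightarrow> nat) \<Rightarrow> real \<Rightarrow> (nat \<Rightarrow> nat) \<Rightarrow> nat" where
  "\<Theta> b \<eta> \<tau> \<theta> \<alpha> \<gamma> \<epsilon> g = metastability_bound.\<Theta>' b \<eta> \<tau> \<theta> \<alpha> \<gamma> (\<epsilon> / 2) g"

text \<open>
  The modulus on the positive reals given by a number-theoretic function \<open>f\<close>, where a natural
  number \<open>n\<close> stands for \<open>1 / (n + 1)\<close>. A real argument \<open>s\<close> is replaced by the largest number of this form
  that is at most \<open>s\<close> (if \<open>s > 0\<close>). A modulus of uniform convexity, uniform smoothness or uniform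
  continuity stays one when its argument is first decreased, so if \<open>f\<close> represents such a modulus
  at the arguments \<open>1 / (n + 1)\<close>, then \<open>real_modulus f\<close> is one at all of its arguments.
\<close>

definition real_modulus :: "(nat \<Rightarrow> nat) \<Rightarrow> real \<Rightarrow> real" where
  "real_modulus f s = 1 / (real (f (nat \<lceil>1 / s\<rceil> - 1)) + 1)"

end

theory Submission
  imports Defs
begin

text \<open>
  The only recursion in the bound whose type level exceeds one is that for \<open>(M, U)\<close>. On the
  arguments that occur, \<open>M\<close> is constantly 0 and \<open>U\<close> depends on a single number, so an element of
  \<open>S \<times> \<nat>\<close> can be replaced by a pair of a number-theoretic function and a number, and the recursion
  by one with values in \<open>\<nat> \<Rightarrow> \<nat>\<close>; the functionals \<open>N\<close> and \<open>T\<close> even become explicit. All real quantities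
  are reciprocals of natural numbers, so they are computed by addition, multiplication and maximum.
  The resulting function is definable: some closed term of \<open>T\<^sub>1\<close> is related to it by the logical
  relation that extends \<open>\<Down>\<close> to functions.
\<close>

section \<open>Definability in \<open>T\<^sub>1\<close>\<close>

text \<open>The values of \<open>MU\<close> are functionals with a function argument, hence of level
  2, so that recursion as written calls for a recursor outside \<open>T\<^sub>1\<close>. The
  reduction is an exact equality of values, not a majorization: all arguments of M and U but the
  last reach \<Omega> only in components that no counterfunction reads. Exactness on the real side
  comes from \<open>real_modulus\<close>. At 1/N its ceiling does not round, so moduli, products and
  minima never leave the reciprocals of positive integers; b \<ge> 1 and \<gamma> n \<ge> 1 keep the
  denominators positive. No approximation or comparison of reals has to be programmed in the
  calculus. The logical relation ranges over HOL functions of different types. Overloading in a type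
  class plays the role of recursion on finite types, and the class axiom, closure under expansion,
  is what makes the combinators and recursors represent their intended values.\<close>

class finite_type =
  fixes ty_of :: "'a itself \<Rightarrow> ty"
    and represents :: "trm \<Rightarrow> 'a \<Rightarrow> bool"
  assumes represents_red: "red\<^sup>*\<^sup>* s t \<Longrightarrow> represents t x \<Longrightarrow> represents s x"

instantiation nat :: finite_type
begin

definition ty_of_nat :: "nat itself \<Rightarrow> ty" where
  "ty_of_nat _ = TNat"

definition represents_nat :: "trm \<Rightarrow> nat \<Rightarrow> bool" where
  "represents_nat t n \<longleftrightarrow> t \<Down> n"

instance
  by standard (auto simp: represents_nat_def evaluates_to_def)

end

lemma red_AppL_rtranclp: "red\<^sup>*\<^sup>* s s' \<Longrightarrow> red\<^sup>*\<^sup>* (s \<cdot> t) (s' \<cdot> t)"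
  by (induction rule: rtranclp_induct) (auto intro: red_AppL rtranclp.rtrancl_into_rtrancl)

lemma red_AppR_rtranclp: "red\<^sup>*\<^sup>* t t' \<Longrightarrow> red\<^sup>*\<^sup>* (s \<cdot> t) (s \<cdot> t')"
  by (induction rule: rtranclp_induct) (auto intro: red_AppR rtranclp.rtrancl_into_rtrancl)

lemma red_foldl_App: "red\<^sup>*\<^sup>* s s' \<Longrightarrow> red\<^sup>*\<^sup>* (foldl (\<cdot>) s ts) (foldl (\<cdot>) s' ts)"
  by (induction ts arbitrary: s s') (auto intro: red_AppL_rtranclp)

text \<open>The arrow clause of the logical relation. Closure under expansion passes from the result
  type to the function type because reduction is allowed in the head of an application.\<close>

instantiation "fun" :: (finite_type, finite_type) finite_type
begin

definition ty_of_fun :: "('a \<Rightarrow> 'b) itself \<Rightarrow> ty" where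
  "ty_of_fun _ = ty_of TYPE('a) \<rightarrow>\<^sub>T ty_of TYPE('b)"

definition represents_fun :: "trm \<Rightarrow> ('a \<Rightarrow> 'b) \<Rightarrow> bool" where
  "represents_fun t f \<longleftrightarrow> (\<forall>s x. represents s x \<longrightarrow> represents (t \<cdot> s) (f x))"

instance
  by standard (auto simp: represents_fun_def intro: represents_red red_AppL_rtranclp)

end

lemma represents_App: "represents t f \<Longrightarrow> represents s x \<Longrightarrow> represents (t \<cdot> s) (f x)"
  by (simp add: represents_fun_def)

lemma represents_numeral_trm: "represents (numeral_trm n) n"
  by (simp add: represents_nat_def evaluates_to_def)

text \<open>The rule for \<open>Fct\<close> fires on numerals only, so the argument is first reduced
  to its value. This lets the function parameters of the bound be arbitrary, computable or
  not.\<close>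

lemma represents_Fct: "represents (Fct f) f"
  unfolding represents_fun_def represents_nat_def evaluates_to_def
  by (meson red_AppR_rtranclp red_Fct rtranclp.rtrancl_into_rtrancl)

lemma represents_Succ: "represents Succ Suc"
  unfolding represents_fun_def represents_nat_def evaluates_to_def
  using red_AppR_rtranclp by fastforce

lemma represents_KComb: "represents (KComb \<rho> \<sigma>) (\<lambda>x y. x)"
  unfolding represents_fun_def by (meson r_into_rtranclp red_K represents_red)

text \<open>A represented recursion argument reduces to a numeral, and on numerals the two reduction
  rules follow the equations of \<open>rec_nat\<close>. Reduction does not look at the annotation
  \<open>\<rho>\<close>; its level is controlled by \<open>T1_term\<close>.\<close>

lemma represents_Rec:
  "represents (Rec \<rho>) (rec_nat :: 'a \<Rightarrow> (nat \<Rightarrow> 'a \<Rightarrow> 'a) \<Rightarrow> nat \<Rightarrow> 'a::finite_type)"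
proof -
  have *: "represents (Rec \<rho> \<cdot> s \<cdot> t \<cdot> numeral_trm n) (rec_nat x f n)"
    if "represents s x" "represents t f" for s t n and x :: 'a and f
  proof (induction n)
    case 0
    have "red\<^sup>*\<^sup>* (Rec \<rho> \<cdot> s \<cdot> t \<cdot> numeral_trm 0) s" by (simp add: red_Rec_Zero r_into_rtranclp)
    with that(1) show ?case by (simp add: represents_red)
  next
    case (Suc n)
    have "red\<^sup>*\<^sup>* (Rec \<rho> \<cdot> s \<cdot> t \<cdot> numeral_trm (Suc n))
        (t \<cdot> numeral_trm n \<cdot> (Rec \<rho> \<cdot> s \<cdot> t \<cdot> numeral_trm n))"
      by (simp add: red_Rec_Succ r_into_rtranclp)
    moreover have "represents (t \<cdot> numeral_trm n \<cdot> (Rec \<rho> \<cdot> s \<cdot> t \<cdot> numeral_trm n))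
        (rec_nat x f (Suc n))"
      using represents_App[OF represents_App[OF that(2) represents_numeral_trm] Suc] by simp
    ultimately show ?case by (rule represents_red)
  qed
  have "represents (Rec \<rho> \<cdot> s \<cdot> t \<cdot> r) (rec_nat x f n)"
    if "represents s x" "represents t f" "represents r n" for s t r n and x :: 'a and f
    using *[OF that(1,2)] that(3) red_AppR_rtranclp represents_red
    unfolding represents_nat_def evaluates_to_def by blast
  then show ?thesis unfolding represents_fun_def by blast
qed

section \<open>Closed typed terms and combinators for contexts\<close>

definition T1_term :: "ty \<Rightarrow> trm \<Rightarrow> bool" where
  "T1_term \<rho> t \<longleftrightarrow> in_T1 t \<and> closed_trm t \<and> t :\<^sub>T \<rho>"

lemma T1_term_App: "T1_term (\<rho> \<rightarrow>\<^sub>T \<sigma>) s \<Longrightarrow> T1_term \<rho> t \<Longrightarrow> T1_term \<sigma> (s \<cdot> t)"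
  by (auto simp: T1_term_def intro: has_type.intros)

lemma T1_term_KComb: "T1_term (\<rho> \<rightarrow>\<^sub>T \<sigma> \<rightarrow>\<^sub>T \<rho>) (KComb \<rho> \<sigma>)"
  by (auto simp: T1_term_def intro: has_type.intros)

lemma T1_term_SComb:
  "T1_term ((\<rho> \<rightarrow>\<^sub>T \<sigma> \<rightarrow>\<^sub>T \<tau>) \<rightarrow>\<^sub>T (\<rho> \<rightarrow>\<^sub>T \<sigma>) \<rightarrow>\<^sub>T \<rho> \<rightarrow>\<^sub>T \<tau>) (SComb \<rho> \<sigma> \<tau>)"
  by (auto simp: T1_term_def intro: has_type.intros)

lemma T1_term_Succ: "T1_term (TNat \<rightarrow>\<^sub>T TNat) Succ"
  by (auto simp: T1_term_def intro: has_type.intros)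

lemma T1_term_Rec:
  "level \<rho> \<le> 1 \<Longrightarrow> T1_term (\<rho> \<rightarrow>\<^sub>T (TNat \<rightarrow>\<^sub>T \<rho> \<rightarrow>\<^sub>T \<rho>) \<rightarrow>\<^sub>T TNat \<rightarrow>\<^sub>T \<rho>) (Rec \<rho>)"
  by (auto simp: T1_term_def intro: has_type.intros)

lemma T1_term_numeral_trm: "T1_term TNat (numeral_trm n)"
  by (induction n) (auto simp: T1_term_def intro: has_type.intros)

text \<open>
  A context lists the types of the variables on which a definition may depend and says which
  argument terms represent a given HOL value of these variables. HOL terms with free variables
  then become functions on contexts, so that definability can be established by syntax-directed
  rules.
\<close>

type_synonym 'c ctx = "ty list \<times> (trm list \<Rightarrow> 'c \<Rightarrow> bool)"

definition empty_ctx :: "unit ctx" where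
  "empty_ctx = ([], \<lambda>_ _. True)"

definition ext :: "'c ctx \<Rightarrow> ('c \<times> 'a::finite_type) ctx" where
  "ext G = (fst G @ [ty_of TYPE('a)],
     \<lambda>ts (c, x). \<exists>ts' s. ts = ts' @ [s] \<and> snd G ts' c \<and> represents s x)"

definition definable :: "'c ctx \<Rightarrow> ('c \<Rightarrow> 'a::finite_type) \<Rightarrow> bool" where
  "definable G F \<longleftrightarrow> (\<exists>t. T1_term (foldr (\<rightarrow>\<^sub>T) (fst G) (ty_of TYPE('a))) t \<and>
     (\<forall>ts c. length ts = length (fst G) \<longrightarrow> snd G ts c \<longrightarrow> represents (foldl (\<cdot>) t ts) (F c)))"

text \<open>One \<open>KComb\<close> per variable of the context discards the arguments, so closed
  terms can be used below variables without lambda abstraction.\<close>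

lemma const_combinator:
  assumes "T1_term \<rho> t"
  shows "\<exists>s. T1_term (foldr (\<rightarrow>\<^sub>T) \<Gamma> \<rho>) s \<and>
    (\<forall>ts. length ts = length \<Gamma> \<longrightarrow> red\<^sup>*\<^sup>* (foldl (\<cdot>) s ts) t)"
proof (induction \<Gamma>)
  case Nil
  then show ?case using assms by auto
next
  case (Cons \<gamma> \<Gamma>)
  then obtain s where s: "T1_term (foldr (\<rightarrow>\<^sub>T) \<Gamma> \<rho>) s"
    "\<And>ts. length ts = length \<Gamma> \<Longrightarrow> red\<^sup>*\<^sup>* (foldl (\<cdot>) s ts) t" by blast
  have "red\<^sup>*\<^sup>* (foldl (\<cdot>) (KComb (foldr (\<rightarrow>\<^sub>T) \<Gamma> \<rho>) \<gamma> \<cdot> s) ts) t"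
    if len: "length ts = length (\<gamma> # \<Gamma>)" for ts
  proof -
    obtain r ts' where ts: "ts = r # ts'" "length ts' = length \<Gamma>"
      using len by (cases ts) auto
    have "red\<^sup>*\<^sup>* (foldl (\<cdot>) (KComb (foldr (\<rightarrow>\<^sub>T) \<Gamma> \<rho>) \<gamma> \<cdot> s \<cdot> r) ts') (foldl (\<cdot>) s ts')"
      by (intro red_foldl_App r_into_rtranclp red_K)
    with s(2)[OF ts(2)] ts(1) show ?thesis by simp
  qed
  moreover have "T1_term (foldr (\<rightarrow>\<^sub>T) (\<gamma> # \<Gamma>) \<rho>) (KComb (foldr (\<rightarrow>\<^sub>T) \<Gamma> \<rho>) \<gamma> \<cdot> s)"
    using s(1) T1_term_App T1_term_KComb by fastforce
  ultimately show ?case by blast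
qed

text \<open>
  Application under one more variable: \<open>S (K S) (S (K s))\<close> sends \<open>f\<close>, \<open>g\<close>, \<open>x\<close> to
  \<open>s (f x) (g x)\<close>.
\<close>

lemma app_combinator:
  "\<exists>s. T1_term (foldr (\<rightarrow>\<^sub>T) \<Gamma> (\<rho> \<rightarrow>\<^sub>T \<sigma>) \<rightarrow>\<^sub>T foldr (\<rightarrow>\<^sub>T) \<Gamma> \<rho> \<rightarrow>\<^sub>T foldr (\<rightarrow>\<^sub>T) \<Gamma> \<sigma>) s \<and>
    (\<forall>f g ts. length ts = length \<Gamma> \<longrightarrow>
      red\<^sup>*\<^sup>* (foldl (\<cdot>) (s \<cdot> f \<cdot> g) ts) (foldl (\<cdot>) f ts \<cdot> foldl (\<cdot>) g ts))"
proof (induction \<Gamma>)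
  case Nil
  \<comment> \<open>Over the empty context the combinator has to be the identity on
    \<open>\<rho> \<rightarrow>\<^sub>T \<sigma>\<close>, written as S K K.\<close>
  let ?I = "SComb (\<rho> \<rightarrow>\<^sub>T \<sigma>) (\<rho> \<rightarrow>\<^sub>T \<rho> \<rightarrow>\<^sub>T \<sigma>) (\<rho> \<rightarrow>\<^sub>T \<sigma>) \<cdot>
    KComb (\<rho> \<rightarrow>\<^sub>T \<sigma>) (\<rho> \<rightarrow>\<^sub>T \<rho> \<rightarrow>\<^sub>T \<sigma>) \<cdot> KComb (\<rho> \<rightarrow>\<^sub>T \<sigma>) \<rho>"
  have "T1_term ((\<rho> \<rightarrow>\<^sub>T \<sigma>) \<rightarrow>\<^sub>T \<rho> \<rightarrow>\<^sub>T \<sigma>) ?I"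
    by (rule T1_term_App T1_term_SComb T1_term_KComb)+
  moreover have "red\<^sup>*\<^sup>* (?I \<cdot> f) f" for f
    by (meson r_into_rtranclp red_S red_K rtranclp.rtrancl_into_rtrancl)
  ultimately show ?case by (auto intro!: exI[of _ ?I] red_AppL_rtranclp)
next
  case (Cons \<gamma> \<Gamma>)
  let ?X = "foldr (\<rightarrow>\<^sub>T) \<Gamma> (\<rho> \<rightarrow>\<^sub>T \<sigma>)" and ?Y = "foldr (\<rightarrow>\<^sub>T) \<Gamma> \<rho>" and ?Z = "foldr (\<rightarrow>\<^sub>T) \<Gamma> \<sigma>"
  from Cons obtain s where s: "T1_term (?X \<rightarrow>\<^sub>T ?Y \<rightarrow>\<^sub>T ?Z) s"
    "\<And>f g ts. length ts = length \<Gamma> \<Longrightarrow>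
      red\<^sup>*\<^sup>* (foldl (\<cdot>) (s \<cdot> f \<cdot> g) ts) (foldl (\<cdot>) f ts \<cdot> foldl (\<cdot>) g ts)" by blast
  let ?S = "SComb \<gamma> ?Y ?Z" and ?B = "SComb \<gamma> ?X (?Y \<rightarrow>\<^sub>T ?Z)"
    and ?K = "KComb (?X \<rightarrow>\<^sub>T ?Y \<rightarrow>\<^sub>T ?Z) \<gamma>"
  let ?K' = "KComb ((\<gamma> \<rightarrow>\<^sub>T ?Y \<rightarrow>\<^sub>T ?Z) \<rightarrow>\<^sub>T (\<gamma> \<rightarrow>\<^sub>T ?Y) \<rightarrow>\<^sub>T \<gamma> \<rightarrow>\<^sub>T ?Z) (\<gamma> \<rightarrow>\<^sub>T ?X)"
  let ?s = "SComb (\<gamma> \<rightarrow>\<^sub>T ?X) (\<gamma> \<rightarrow>\<^sub>T ?Y \<rightarrow>\<^sub>T ?Z) ((\<gamma> \<rightarrow>\<^sub>T ?Y) \<rightarrow>\<^sub>T \<gamma> \<rightarrow>\<^sub>T ?Z) \<cdot>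
    (?K' \<cdot> ?S) \<cdot> (?B \<cdot> (?K \<cdot> s))"
  have "T1_term ((\<gamma> \<rightarrow>\<^sub>T ?X) \<rightarrow>\<^sub>T (\<gamma> \<rightarrow>\<^sub>T ?Y) \<rightarrow>\<^sub>T \<gamma> \<rightarrow>\<^sub>T ?Z) ?s"
    by (rule T1_term_SComb T1_term_KComb s(1) T1_term_App)+
  moreover have "red\<^sup>*\<^sup>* (foldl (\<cdot>) (?s \<cdot> f \<cdot> g) ts) (foldl (\<cdot>) f ts \<cdot> foldl (\<cdot>) g ts)"
    if len: "length ts = length (\<gamma> # \<Gamma>)" for f g ts
  proof -
    obtain x ts' where ts: "ts = x # ts'" "length ts' = length \<Gamma>"
      using len by (cases ts) auto
    have "red\<^sup>*\<^sup>* (?s \<cdot> f \<cdot> g \<cdot> x) (?K' \<cdot> ?S \<cdot> f \<cdot> (?B \<cdot> (?K \<cdot> s) \<cdot> f) \<cdot> g \<cdot> x)"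
      by (intro red_AppL_rtranclp r_into_rtranclp red_S)
    moreover have "red\<^sup>*\<^sup>* (?K' \<cdot> ?S \<cdot> f \<cdot> (?B \<cdot> (?K \<cdot> s) \<cdot> f) \<cdot> g \<cdot> x)
        (?S \<cdot> (?B \<cdot> (?K \<cdot> s) \<cdot> f) \<cdot> g \<cdot> x)"
      by (intro red_AppL_rtranclp r_into_rtranclp red_K)
    moreover have "red\<^sup>*\<^sup>* (?S \<cdot> (?B \<cdot> (?K \<cdot> s) \<cdot> f) \<cdot> g \<cdot> x) (?B \<cdot> (?K \<cdot> s) \<cdot> f \<cdot> x \<cdot> (g \<cdot> x))"
      by (intro r_into_rtranclp red_S)
    moreover have "red\<^sup>*\<^sup>* (?B \<cdot> (?K \<cdot> s) \<cdot> f \<cdot> x \<cdot> (g \<cdot> x)) (?K \<cdot> s \<cdot> x \<cdot> (f \<cdot> x) \<cdot> (g \<cdot> x))"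
      by (intro red_AppL_rtranclp r_into_rtranclp red_S)
    moreover have "red\<^sup>*\<^sup>* (?K \<cdot> s \<cdot> x \<cdot> (f \<cdot> x) \<cdot> (g \<cdot> x)) (s \<cdot> (f \<cdot> x) \<cdot> (g \<cdot> x))"
      by (intro red_AppL_rtranclp r_into_rtranclp red_K)
    ultimately have "red\<^sup>*\<^sup>* (?s \<cdot> f \<cdot> g \<cdot> x) (s \<cdot> (f \<cdot> x) \<cdot> (g \<cdot> x))"
      by (meson rtranclp_trans)
    then have "red\<^sup>*\<^sup>* (foldl (\<cdot>) (?s \<cdot> f \<cdot> g \<cdot> x) ts') (foldl (\<cdot>) (s \<cdot> (f \<cdot> x) \<cdot> (g \<cdot> x)) ts')"
      by (rule red_foldl_App)
    from rtranclp_trans[OF this s(2)[OF ts(2)]] show ?thesis using ts(1) by simp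
  qed
  ultimately show ?case by (intro exI[of _ ?s]) simp
qed

section \<open>Structural rules of definability\<close>

lemma definable_closed:
  fixes x :: "'a::finite_type"
  assumes "T1_term (ty_of TYPE('a)) t" and "represents t x"
  shows "definable G (\<lambda>_. x)"
  using const_combinator[OF assms(1), of "fst G"] assms(2)
  unfolding definable_def by (blast intro: represents_red)

text \<open>Bracket abstraction in one step: \<open>app_combinator\<close> passes the variables on
  to the closed terms for \<open>F\<close> and \<open>A\<close>. Together with the rules for
  constants and variables this replaces a translation of lambda terms.\<close>

lemma definable_app:
  fixes F :: "'c \<Rightarrow> 'a::finite_type \<Rightarrow> 'b::finite_type"
  assumes "definable G F" and "definable G A"
  shows "definable G (\<lambda>c. F c (A c))"
proof -
  let ?a = "ty_of TYPE('a)" and ?b = "ty_of TYPE('b)" and ?\<Gamma> = "fst G"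
  obtain f where f: "T1_term (foldr (\<rightarrow>\<^sub>T) ?\<Gamma> (?a \<rightarrow>\<^sub>T ?b)) f"
    "\<And>ts c. length ts = length ?\<Gamma> \<Longrightarrow> snd G ts c \<Longrightarrow> represents (foldl (\<cdot>) f ts) (F c)"
    using assms(1) by (auto simp: definable_def ty_of_fun_def)
  obtain a where a: "T1_term (foldr (\<rightarrow>\<^sub>T) ?\<Gamma> ?a) a"
    "\<And>ts c. length ts = length ?\<Gamma> \<Longrightarrow> snd G ts c \<Longrightarrow> represents (foldl (\<cdot>) a ts) (A c)"
    using assms(2) by (auto simp: definable_def)
  obtain s where s: "T1_term (foldr (\<rightarrow>\<^sub>T) ?\<Gamma> (?a \<rightarrow>\<^sub>T ?b) \<rightarrow>\<^sub>T foldr (\<rightarrow>\<^sub>T) ?\<Gamma> ?a \<rightarrow>\<^sub>T foldr (\<rightarrow>\<^sub>T) ?\<Gamma> ?b) s"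
    "\<And>f g ts. length ts = length ?\<Gamma> \<Longrightarrow>
      red\<^sup>*\<^sup>* (foldl (\<cdot>) (s \<cdot> f \<cdot> g) ts) (foldl (\<cdot>) f ts \<cdot> foldl (\<cdot>) g ts)"
    using app_combinator by blast
  show ?thesis
    unfolding definable_def
  proof (intro exI conjI allI impI)
    show "T1_term (foldr (\<rightarrow>\<^sub>T) ?\<Gamma> ?b) (s \<cdot> f \<cdot> a)"
      using s(1) f(1) a(1) T1_term_App by blast
    show "represents (foldl (\<cdot>) (s \<cdot> f \<cdot> a) ts) (F c (A c))"
      if "length ts = length ?\<Gamma>" "snd G ts c" for ts c
      using represents_red[OF s(2)] represents_App f(2) a(2) that by blast
  qed
qed

lemma definable_app2:
  fixes F :: "'c \<Rightarrow> 'a::finite_type \<Rightarrow> 'b::finite_type \<Rightarrow> 'd::finite_type"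
  shows "definable G F \<Longrightarrow> definable G A \<Longrightarrow> definable G B \<Longrightarrow> definable G (\<lambda>c. F c (A c) (B c))"
  by (rule definable_app[OF definable_app])

text \<open>The same term serves both sides: appending a type to the context only regroups the arrow
  type, and appending a term to the argument list is one more application.\<close>

lemma definable_uncurry:
  fixes F :: "'c \<Rightarrow> 'a::finite_type \<Rightarrow> 'b::finite_type"
  shows "definable (ext G) (\<lambda>p. F (fst p) (snd p)) \<longleftrightarrow> definable G F"
proof
  assume "definable (ext G) (\<lambda>p. F (fst p) (snd p))"
  then obtain t where t: "T1_term (foldr (\<rightarrow>\<^sub>T) (fst G) (ty_of TYPE('a \<Rightarrow> 'b))) t"
    "\<And>ts p. length ts = Suc (length (fst G)) \<Longrightarrow> snd (ext G) ts p \<Longrightarrow>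
      represents (foldl (\<cdot>) t ts) (F (fst p) (snd p))"
    by (auto simp: definable_def ext_def ty_of_fun_def)
  have "represents (foldl (\<cdot>) t ts) (F c)" if "length ts = length (fst G)" "snd G ts c" for ts c
    unfolding represents_fun_def
    using that t(2)[of "ts @ [s]" "(c, x)" for s x] by (auto simp: ext_def)
  with t(1) show "definable G F" unfolding definable_def by blast
next
  assume "definable G F"
  then show "definable (ext G) (\<lambda>p. F (fst p) (snd p))"
    by (force simp: definable_def ext_def ty_of_fun_def intro: represents_App)
qed

lemmas definable_lam = definable_uncurry[THEN iffD1]

lemma definable_id: "definable G (\<lambda>_. (\<lambda>x::'a::finite_type. x))"
proof (rule definable_closed)
  let ?a = "ty_of TYPE('a)"
  let ?I = "SComb ?a (?a \<rightarrow>\<^sub>T ?a) ?a \<cdot> KComb ?a (?a \<rightarrow>\<^sub>T ?a) \<cdot> KComb ?a ?a"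
  show "T1_term (ty_of TYPE('a \<Rightarrow> 'a)) ?I"
    unfolding ty_of_fun_def by (rule T1_term_App T1_term_SComb T1_term_KComb)+
  have "red\<^sup>*\<^sup>* (?I \<cdot> s) s" for s
    by (meson r_into_rtranclp red_S red_K rtranclp.rtrancl_into_rtrancl)
  then show "represents ?I (\<lambda>x::'a. x)"
    unfolding represents_fun_def using represents_red by blast
qed

lemma definable_snd: "definable (ext G) (\<lambda>p. snd p :: 'a::finite_type)"
  by (rule definable_uncurry[THEN iffD2, OF definable_id])

text \<open>Weakening by the newest variable, which \<open>KComb\<close> discards. Iterated and
  combined with \<open>definable_snd\<close>, it gives access to every variable of a
  context.\<close>

lemma definable_fst:
  fixes F :: "'c \<Rightarrow> 'b::finite_type"
  assumes "definable G F"
  shows "definable (ext G :: ('c \<times> 'a::finite_type) ctx) (\<lambda>p. F (fst p))"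
proof -
  have "definable G (\<lambda>_. (\<lambda>(x::'b) (y::'a). x))"
    by (rule definable_closed[OF _ represents_KComb[of "ty_of TYPE('b)" "ty_of TYPE('a)"]])
      (simp add: ty_of_fun_def T1_term_KComb)
  from definable_app[OF this assms] show ?thesis
    by (subst (asm) definable_uncurry[symmetric])
qed

text \<open>The conclusion of \<open>definable_app\<close> unifies with any term and is unfit as an
  introduction rule. Fixing the head to a variable of the context makes it usable as one.\<close>

lemma definable_app_snd:
  fixes P :: "'c \<Rightarrow> 'e \<times> ('a::finite_type \<Rightarrow> 'b::finite_type)"
  shows "definable G (\<lambda>c. snd (P c)) \<Longrightarrow> definable G A \<Longrightarrow> definable G (\<lambda>c. snd (P c) (A c))"
  by (rule definable_app)

section \<open>Definability of arithmetic\<close>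

named_theorems definable_intros

lemma definable_nat [definable_intros]: "definable G (\<lambda>_. n::nat)"
  by (rule definable_closed[OF _ represents_numeral_trm])
    (simp add: ty_of_nat_def T1_term_numeral_trm)

lemma definable_Suc [definable_intros]: "definable G F \<Longrightarrow> definable G (\<lambda>c. Suc (F c))"
  by (rule definable_app[OF definable_closed[OF _ represents_Succ]])
    (auto simp: ty_of_fun_def ty_of_nat_def T1_term_Succ)

text \<open>The only rule that introduces a recursor, hence the only place where the level
  restriction of \<open>T\<^sub>1\<close> has to be checked.\<close>

lemma definable_rec:
  fixes A :: "'c \<Rightarrow> 'a::finite_type"
  assumes "level (ty_of TYPE('a)) \<le> 1"
    and "definable G A" and "definable G B" and "definable G N"
  shows "definable G (\<lambda>c. rec_nat (A c) (B c) (N c))"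
proof -
  have "definable G (\<lambda>_. rec_nat :: 'a \<Rightarrow> (nat \<Rightarrow> 'a \<Rightarrow> 'a) \<Rightarrow> nat \<Rightarrow> 'a)"
    by (rule definable_closed[OF _ represents_Rec[of "ty_of TYPE('a)"]])
      (simp add: ty_of_fun_def ty_of_nat_def T1_term_Rec[OF assms(1)])
  from definable_app[OF definable_app[OF definable_app[OF this assms(2)] assms(3)] assms(4)]
  show ?thesis .
qed

lemma definable_rec_nat [definable_intros]:
  fixes A :: "'c \<Rightarrow> nat"
  assumes "definable G A"
    and "definable (ext (ext G)) (\<lambda>p. B (fst (fst p)) (snd (fst p)) (snd p))" and "definable G N"
  shows "definable G (\<lambda>c. rec_nat (A c) (B c) (N c))"
proof (rule definable_rec[OF _ assms(1) _ assms(3)])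
  show "definable G B"
    by (intro definable_lam) (fact assms(2))
qed (simp add: ty_of_nat_def)

lemma definable_add [definable_intros]:
  fixes A B :: "'c \<Rightarrow> nat"
  assumes "definable G A" and "definable G B"
  shows "definable G (\<lambda>c. A c + B c)"
proof -
  have *: "m + n = rec_nat n (\<lambda>_ x. Suc x) m" for m n :: nat
    by (induction m) auto
  show ?thesis
    unfolding * by (intro definable_intros definable_snd assms)
qed

lemma definable_mult [definable_intros]:
  fixes A B :: "'c \<Rightarrow> nat"
  assumes "definable G A" and "definable G B"
  shows "definable G (\<lambda>c. A c * B c)"
proof -
  have *: "m * n = rec_nat 0 (\<lambda>_ x. n + x) m" for m n :: nat
    by (induction m) auto
  show ?thesis
    unfolding * by (intro definable_intros definable_snd definable_fst assms)
qed

lemma definable_diff [definable_intros]: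
  fixes A B :: "'c \<Rightarrow> nat"
  assumes "definable G A" and "definable G B"
  shows "definable G (\<lambda>c. A c - B c)"
proof -
  have "rec_nat 0 (\<lambda>i _. i) m = m - 1" for m :: nat
    by (cases m) auto
  then have *: "m - n = rec_nat m (\<lambda>_ x. rec_nat 0 (\<lambda>i _. i) x) n" for m n :: nat
    by (induction n) auto
  show ?thesis
    unfolding * by (intro definable_intros definable_snd definable_fst assms)
qed

lemma definable_max [definable_intros]:
  fixes A B :: "'c \<Rightarrow> nat"
  assumes "definable G A" and "definable G B"
  shows "definable G (\<lambda>c. max (A c) (B c))"
proof -
  have *: "max m n = m + (n - m)" for m n :: nat
    by auto
  show ?thesis
    unfolding * by (intro definable_intros assms)
qed

text \<open>The exponent is a constant, so the induction runs outside the calculus and yields a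
  product.\<close>

lemma definable_power [definable_intros]:
  fixes A :: "'c \<Rightarrow> nat"
  assumes "definable G A"
  shows "definable G (\<lambda>c. A c ^ n)"
  by (induction n) (auto intro: definable_intros assms)

lemma running_max_0: "running_max f 0 = f 0"
  by (simp add: running_max_def)

lemma running_max_Suc: "running_max f (Suc n) = max (f (Suc n)) (running_max f n)"
  by (simp add: running_max_def atMost_Suc)

lemma definable_running_max [definable_intros]:
  assumes "definable G F" and "definable G N"
  shows "definable G (\<lambda>c. running_max (F c) (N c))"
proof -
  have *: "running_max f n = rec_nat (f 0) (\<lambda>i x. max (f (Suc i)) x) n" for f n
    by (induction n) (auto simp: running_max_0 running_max_Suc)
  note F' = definable_fst[OF definable_fst[OF assms(1)]]
  show ?thesis
    unfolding *
    by (intro definable_intros definable_snd definable_fst[OF definable_snd]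
        assms(1)[THEN definable_app] F'[THEN definable_app] assms)
qed

section \<open>Reciprocals of the real quantities\<close>

text \<open>
  The values of \<open>\<omega>\<close> and \<open>\<nu>\<^sub>4\<close> are reciprocals of even numbers; since \<open>u\<close> involves \<open>2 \<nu>\<^sub>4 \<delta> / 3\<close>,
  it is half of the reciprocal of \<open>\<nu>\<^sub>4\<close> that is needed.
\<close>

definition inv_psi :: "nat \<Rightarrow> (nat \<Rightarrow> nat) \<Rightarrow> nat \<Rightarrow> nat" where
  "inv_psi b \<eta> A = max (4 * (max (2 * A) (72 * b * A\<^sup>2 * (Suc (\<eta> (2 * b * A - 1)))\<^sup>2))\<^sup>2)
     (48 * A\<^sup>2 * (Suc (\<eta> (2 * b * A - 1)))\<^sup>2)"

definition half_inv_omega :: "nat \<Rightarrow> (nat \<Rightarrow> nat) \<Rightarrow> nat \<Rightarrow> nat" where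
  "half_inv_omega b \<tau> A = 6 * b * A\<^sup>2 * Suc (\<tau> (2 * b * A - 1))"

definition inv_theta' :: "(nat \<Rightarrow> nat) \<Rightarrow> nat \<Rightarrow> nat" where
  "inv_theta' \<theta> A = max (4 * A) (Suc (\<theta> (2 * A - 1)))"

text \<open>\<open>E\<close> is the reciprocal of \<epsilon>. The constants are halves of 9216, 4
  and 16, where 4 comes from squaring \<omega> = 1/(2w).\<close>

definition half_inv_nu4 :: "nat \<Rightarrow> (nat \<Rightarrow> nat) \<Rightarrow> nat \<Rightarrow> nat" where
  "half_inv_nu4 b \<tau> E =
     max (4608 * b\<^sup>2 * E ^ 4) (max (2 * (half_inv_omega b \<tau> (96 * b * E\<^sup>2))\<^sup>2) (8 * E\<^sup>2))"

definition inv_delta :: "nat \<Rightarrow> (nat \<Rightarrow> nat) \<Rightarrow> nat \<Rightarrow> nat" where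
  "inv_delta b \<tau> E = max (2 * half_inv_omega b \<tau> (6 * b * half_inv_nu4 b \<tau> E) * b) 4"

definition inv_pe :: "nat \<Rightarrow> (nat \<Rightarrow> nat) \<Rightarrow> nat \<Rightarrow> nat" where
  "inv_pe b \<tau> E = max (6 * half_inv_nu4 b \<tau> E) (96 * E\<^sup>2)"

definition inv_nu2 :: "nat \<Rightarrow> (nat \<Rightarrow> nat) \<Rightarrow> (nat \<Rightarrow> nat) \<Rightarrow> nat \<Rightarrow> nat" where
  "inv_nu2 b \<eta> \<tau> E = 2 * inv_psi b \<eta> (2 * half_inv_omega b \<tau> (2 * b * inv_pe b \<tau> E))"

definition inv_u :: "nat \<Rightarrow> (nat \<Rightarrow> nat) \<Rightarrow> (nat \<Rightarrow> nat) \<Rightarrow> nat \<Rightarrow> nat" where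
  "inv_u b \<eta> \<tau> E = max (3 * half_inv_nu4 b \<tau> E * inv_delta b \<tau> E) (inv_nu2 b \<eta> \<tau> E)"

definition inv_nu1 :: "nat \<Rightarrow> (nat \<Rightarrow> nat) \<Rightarrow> (nat \<Rightarrow> nat) \<Rightarrow> (nat \<Rightarrow> nat) \<Rightarrow> (nat \<Rightarrow> nat) \<Rightarrow> nat \<Rightarrow>
    (nat \<Rightarrow> nat) \<Rightarrow> nat \<Rightarrow> nat \<Rightarrow> nat" where
  "inv_nu1 b \<eta> \<tau> \<theta> \<gamma> E g m n =
     2 * running_max (\<lambda>c. inv_psi b \<eta> (inv_theta' \<theta> (2 * b * \<gamma> c * inv_pe b \<tau> E)))
       (max m (n + running_max g n))"

section \<open>Definability of the reciprocals\<close>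

lemma definable_inv_psi [definable_intros]:
  assumes "definable G b" and "definable G \<eta>" and "definable G A"
  shows "definable G (\<lambda>c. inv_psi (b c) (\<eta> c) (A c))"
  unfolding inv_psi_def by (intro definable_intros assms assms(2)[THEN definable_app])

lemma definable_half_inv_omega [definable_intros]:
  assumes "definable G b" and "definable G \<tau>" and "definable G A"
  shows "definable G (\<lambda>c. half_inv_omega (b c) (\<tau> c) (A c))"
  unfolding half_inv_omega_def by (intro definable_intros assms assms(2)[THEN definable_app])

lemma definable_inv_theta' [definable_intros]:
  assumes "definable G \<theta>" and "definable G A"
  shows "definable G (\<lambda>c. inv_theta' (\<theta> c) (A c))"
  unfolding inv_theta'_def by (intro definable_intros assms assms(1)[THEN definable_app])

lemma definable_half_inv_nu4 [definable_intros]: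
  assumes "definable G b" and "definable G \<tau>" and "definable G E"
  shows "definable G (\<lambda>c. half_inv_nu4 (b c) (\<tau> c) (E c))"
  unfolding half_inv_nu4_def by (intro definable_intros assms)

lemma definable_inv_delta [definable_intros]:
  assumes "definable G b" and "definable G \<tau>" and "definable G E"
  shows "definable G (\<lambda>c. inv_delta (b c) (\<tau> c) (E c))"
  unfolding inv_delta_def by (intro definable_intros assms)

lemma definable_inv_pe [definable_intros]:
  assumes "definable G b" and "definable G \<tau>" and "definable G E"
  shows "definable G (\<lambda>c. inv_pe (b c) (\<tau> c) (E c))"
  unfolding inv_pe_def by (intro definable_intros assms)

lemma definable_inv_nu2 [definable_intros]:
  assumes "definable G b" and "definable G \<eta>" and "definable G \<tau>" and "definable G E"
  shows "definable G (\<lambda>c. inv_nu2 (b c) (\<eta> c) (\<tau> c) (E c))"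
  unfolding inv_nu2_def by (intro definable_intros assms)

lemma definable_inv_u [definable_intros]:
  assumes "definable G b" and "definable G \<eta>" and "definable G \<tau>" and "definable G E"
  shows "definable G (\<lambda>c. inv_u (b c) (\<eta> c) (\<tau> c) (E c))"
  unfolding inv_u_def by (intro definable_intros assms)

lemma definable_inv_nu1 [definable_intros]:
  assumes "definable G b" and "definable G \<eta>" and "definable G \<tau>" and "definable G \<theta>"
    and "definable G \<gamma>" and "definable G E" and "definable G g" and "definable G M" and "definable G N"
  shows "definable G (\<lambda>c. inv_nu1 (b c) (\<eta> c) (\<tau> c) (\<theta> c) (\<gamma> c) (E c) (g c) (M c) (N c))"
proof -
  note assms1 = assms[THEN definable_fst]
  show ?thesis
    unfolding inv_nu1_def
    by (intro definable_intros definable_snd assms assms1 assms(7)[THEN definable_app] assms1(5)[THEN definable_app]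
        definable_lam[of _ "\<lambda>c n. inv_psi (b c) (\<eta> c) (inv_theta' (\<theta> c) (2 * b c * \<gamma> c n * inv_pe (b c) (\<tau> c) (E c)))"])
qed

section \<open>The functionals on reduced arguments\<close>

text \<open>This is U(\<Omega>, I(l)) as a function of its last argument, for an \<Omega> whose
  sixth component on the code \<open>(\<phi>, k)\<close> is \<open>f \<phi> k\<close>.\<close>

definition iter_fun :: "nat \<Rightarrow> nat \<Rightarrow> ((nat \<Rightarrow> nat) \<Rightarrow> nat \<Rightarrow> nat) \<Rightarrow> nat \<Rightarrow> nat" where
  "iter_fun b l f = rec_nat (\<lambda>_. 0) (\<lambda>_. f) (2 * b\<^sup>2 * (l + 1))"

text \<open>The number component of \<open>\<Psi>\<close>: \<open>h\<close> describes the fourth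
  component of \<Omega> on codes, and the iteration starts from 0 because \<open>TT\<close> vanishes
  together with \<open>Mbar\<close>.\<close>

definition iter_num ::
  "nat \<Rightarrow> nat \<Rightarrow> ((nat \<Rightarrow> nat) \<Rightarrow> nat \<Rightarrow> nat) \<Rightarrow> ((nat \<Rightarrow> nat) \<Rightarrow> nat \<Rightarrow> nat) \<Rightarrow> nat" where
  "iter_num b l f h = rec_nat 0 (\<lambda>_. h (iter_fun b l f)) (2 * b\<^sup>2 * (l + 1))"

text \<open>The value of F_2 on the codes \<open>(\<phi>, k)\<close> and
  \<open>(\<psi>, l)\<close>.\<close>

definition max4 :: "(nat \<Rightarrow> nat) \<Rightarrow> nat \<Rightarrow> (nat \<Rightarrow> nat) \<Rightarrow> nat \<Rightarrow> nat" where
  "max4 \<phi> k \<psi> l = max (max (\<phi> k) (\<psi> k)) (max (\<phi> l) (\<psi> l))"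

text \<open>The F-component behind both a_v and a_v': \<open>x\<close> is the shift given by
  \<open>\<xi>2\<close> or \<open>\<xi>2'\<close>, and \<open>i\<close> is the value of \<iota>. The
  arguments of the outer \<open>max\<close> come from F_1 and F_2.\<close>

definition fv :: "nat \<Rightarrow> (nat \<Rightarrow> nat) \<Rightarrow> nat \<Rightarrow> nat \<Rightarrow> (nat \<Rightarrow> nat) \<Rightarrow> nat \<Rightarrow> nat" where
  "fv i \<phi> k x \<psi> h = max (i + \<psi> (h + i)) (x + max4 \<phi> k \<psi> (h + x))"

text \<open>The matching fourth component of G: the shifted G_1 contributes \<open>h + i\<close>,
  and G_2 contributes \<open>k\<close>.\<close>

definition hv :: "nat \<Rightarrow> nat \<Rightarrow> (nat \<Rightarrow> nat) \<Rightarrow> nat \<Rightarrow> nat" where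
  "hv i k \<psi> h = max (h + i) k"

text \<open>F_2 shifted by \<open>x\<close> and increased by \<open>\<xi>0\<close>, at the code of
  a_v for \<open>x = k\<close> and of a_v' for \<open>x = k'\<close>. Here \<open>m\<close> and
  \<open>n\<close> are values of \<open>ktilde\<close>, \<open>q\<close> gives the reciprocal of u'
  and \<open>j\<close> the value of \<iota>.\<close>

definition v_bound :: "nat \<Rightarrow> (nat \<Rightarrow> nat \<Rightarrow> nat) \<Rightarrow> (nat \<Rightarrow> nat \<Rightarrow> nat) \<Rightarrow> (nat \<Rightarrow> nat) \<Rightarrow> nat \<Rightarrow>
    (nat \<Rightarrow> nat) \<Rightarrow> nat \<Rightarrow> nat \<Rightarrow> nat" where
  "v_bound b q j \<phi> k \<phi>' k' x =
    (let m = k + \<phi> k; n = k' + \<phi>' k'; f = fv (j m n) \<phi> k x;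
         l = iter_num b (q m n) f (hv (j m n) k)
     in l + max4 \<phi> k (iter_fun b (q m n) f) (l + x))"

definition fw' :: "nat \<Rightarrow> (nat \<Rightarrow> nat \<Rightarrow> nat) \<Rightarrow> (nat \<Rightarrow> nat \<Rightarrow> nat) \<Rightarrow> (nat \<Rightarrow> nat) \<Rightarrow> nat \<Rightarrow>
    (nat \<Rightarrow> nat) \<Rightarrow> nat \<Rightarrow> nat" where
  "fw' b q j \<phi> k \<phi>' k' = max (\<phi>' k') (v_bound b q j \<phi> k \<phi>' k' k')"

definition w'_fun :: "nat \<Rightarrow> nat \<Rightarrow> (nat \<Rightarrow> nat \<Rightarrow> nat) \<Rightarrow> (nat \<Rightarrow> nat \<Rightarrow> nat) \<Rightarrow> (nat \<Rightarrow> nat) \<Rightarrow> nat \<Rightarrow>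
    nat \<Rightarrow> nat" where
  "w'_fun b a q j \<phi> k = iter_fun b a (fw' b q j \<phi> k)"

definition w'_num :: "nat \<Rightarrow> nat \<Rightarrow> (nat \<Rightarrow> nat \<Rightarrow> nat) \<Rightarrow> (nat \<Rightarrow> nat \<Rightarrow> nat) \<Rightarrow> (nat \<Rightarrow> nat) \<Rightarrow> nat \<Rightarrow>
    nat" where
  "w'_num b a q j \<phi> k = iter_num b a (fw' b q j \<phi> k) (\<lambda>\<phi>' k'. max k' k)"

definition fw :: "nat \<Rightarrow> nat \<Rightarrow> (nat \<Rightarrow> nat \<Rightarrow> nat) \<Rightarrow> (nat \<Rightarrow> nat \<Rightarrow> nat) \<Rightarrow> (nat \<Rightarrow> nat) \<Rightarrow> nat \<Rightarrow>
    nat" where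
  "fw b a q j \<phi> k =
    max (\<phi> k) (v_bound b q j \<phi> k (w'_fun b a q j \<phi> k) (w'_num b a q j \<phi> k) k)"

text \<open>\<open>a\<close> is the reciprocal of \<open>u\<close>, and \<open>(\<phi>, k)\<close>
  codes the outermost \<open>\<Psi>\<close>. Both parts of \<open>GFw\<close> have the number of the
  argument as fourth component, whence \<open>\<lambda>\<phi> k. k\<close>.\<close>

definition reduced_bound :: "nat \<Rightarrow> nat \<Rightarrow> (nat \<Rightarrow> nat \<Rightarrow> nat) \<Rightarrow> (nat \<Rightarrow> nat \<Rightarrow> nat) \<Rightarrow> nat" where
  "reduced_bound b a q j =
    (let f = fw b a q j; \<phi> = iter_fun b a f; k = iter_num b a f (\<lambda>\<phi> k. k);
         k' = w'_num b a q j \<phi> k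
     in k' + w'_fun b a q j \<phi> k k')"

section \<open>Definability of the reduced functionals\<close>

lemma definable_iter_fun [definable_intros]:
  assumes "definable G b" and "definable G L" and "definable G F"
  shows "definable G (\<lambda>c. iter_fun (b c) (L c) (F c))"
  unfolding iter_fun_def
  \<comment> \<open>The values are of type \<open>nat \<Rightarrow> nat\<close>, of level 1: this is
    where the recursor for level one enters; all other recursions have values in
    \<open>nat\<close>.\<close>
  by (rule definable_rec)
    (intro definable_intros definable_lam[of _ "\<lambda>_ _. 0"] definable_lam[of _ "\<lambda>c _. F c"]
      definable_fst assms | simp add: ty_of_fun_def ty_of_nat_def)+

lemma definable_iter_num [definable_intros]:
  assumes "definable G b" and "definable G L" and "definable G F" and "definable G H"
  shows "definable G (\<lambda>c. iter_num (b c) (L c) (F c) (H c))"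
  unfolding iter_num_def
  by (rule definable_rec)
    (intro definable_intros definable_lam[of _ "\<lambda>c _. H c (iter_fun (b c) (L c) (F c))"]
      assms[THEN definable_fst] assms(4)[THEN definable_fst, THEN definable_app] assms
      | simp add: ty_of_nat_def)+

lemma definable_max4 [definable_intros]:
  assumes "definable G \<phi>" and "definable G k" and "definable G \<psi>" and "definable G l"
  shows "definable G (\<lambda>c. max4 (\<phi> c) (k c) (\<psi> c) (l c))"
  unfolding max4_def by (intro definable_intros assms assms(1,3)[THEN definable_app])

lemma definable_fv [definable_intros]:
  assumes "definable G i" and "definable G \<phi>" and "definable G k" and "definable G x"
  shows "definable G (\<lambda>c. fv (i c) (\<phi> c) (k c) (x c))"
proof -
  note assms2 = assms[THEN definable_fst, THEN definable_fst]
  show ?thesis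
    by (rule definable_lam, rule definable_lam, unfold fv_def)
      (intro definable_intros definable_snd definable_app_snd definable_fst[OF definable_snd]
        definable_fst[OF definable_snd, THEN definable_app] assms2)
qed

lemma definable_hv [definable_intros]:
  assumes "definable G i" and "definable G k"
  shows "definable G (\<lambda>c. hv (i c) (k c))"
proof -
  note assms2 = assms[THEN definable_fst, THEN definable_fst]
  show ?thesis
    by (rule definable_lam, rule definable_lam, unfold hv_def)
      (intro definable_intros definable_snd assms2)
qed

lemma definable_v_bound [definable_intros]:
  assumes "definable G b" and "definable G q" and "definable G j" and "definable G \<phi>"
    and "definable G k" and "definable G \<phi>'" and "definable G k'" and "definable G x"
  shows "definable G (\<lambda>c. v_bound (b c) (q c) (j c) (\<phi> c) (k c) (\<phi>' c) (k' c) (x c))"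
  unfolding v_bound_def Let_def
  by (intro definable_intros assms assms(2,3)[THEN definable_app2] assms(4,6)[THEN definable_app])

lemma definable_fw' [definable_intros]:
  assumes "definable G b" and "definable G q" and "definable G j" and "definable G \<phi>"
    and "definable G k"
  shows "definable G (\<lambda>c. fw' (b c) (q c) (j c) (\<phi> c) (k c))"
proof -
  note assms2 = assms[THEN definable_fst, THEN definable_fst]
  show ?thesis
    by (rule definable_lam, rule definable_lam, unfold fw'_def)
      (intro definable_intros definable_snd definable_fst[OF definable_snd]
        definable_fst[OF definable_snd, THEN definable_app] assms2)
qed

lemma definable_w'_fun [definable_intros]:
  assumes "definable G b" and "definable G a" and "definable G q" and "definable G j"
    and "definable G \<phi>" and "definable G k"
  shows "definable G (\<lambda>c. w'_fun (b c) (a c) (q c) (j c) (\<phi> c) (k c))"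
  unfolding w'_fun_def by (intro definable_intros assms)

lemma definable_w'_num [definable_intros]:
  assumes "definable G b" and "definable G a" and "definable G q" and "definable G j"
    and "definable G \<phi>" and "definable G k"
  shows "definable G (\<lambda>c. w'_num (b c) (a c) (q c) (j c) (\<phi> c) (k c))"
proof -
  have max: "definable G (\<lambda>c (\<phi>'::nat \<Rightarrow> nat) k'. max k' (k c))"
    by (rule definable_lam, rule definable_lam)
      (intro definable_intros definable_snd assms[THEN definable_fst, THEN definable_fst])
  show ?thesis
    unfolding w'_num_def by (intro definable_intros max assms)
qed

lemma definable_fw [definable_intros]:
  assumes "definable G b" and "definable G a" and "definable G q" and "definable G j"
  shows "definable G (\<lambda>c. fw (b c) (a c) (q c) (j c))"
proof -
  note assms2 = assms[THEN definable_fst, THEN definable_fst]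
  show ?thesis
    by (rule definable_lam, rule definable_lam, unfold fw_def)
      (intro definable_intros definable_snd definable_fst[OF definable_snd]
        definable_fst[OF definable_snd, THEN definable_app] assms2)
qed

lemma definable_reduced_bound [definable_intros]:
  assumes "definable G b" and "definable G a" and "definable G q" and "definable G j"
  shows "definable G (\<lambda>c. reduced_bound (b c) (a c) (q c) (j c))"
proof -
  have num: "definable G (\<lambda>c (\<phi>::nat \<Rightarrow> nat) (k::nat). k)"
    by (rule definable_lam, rule definable_lam, rule definable_snd)
  \<comment> \<open>The rule for \<open>w'_fun\<close> covers six arguments; its value is a function
    here applied to a seventh.\<close>
  have w: "definable G (\<lambda>c. w'_fun (b c) (a c) (q c) (j c) (\<Phi> c) (k c) (x c))"
    if "definable G \<Phi>" "definable G k" "definable G x" for \<Phi> k x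
    by (rule definable_app) (intro definable_intros assms that)+
  show ?thesis
    unfolding reduced_bound_def Let_def by (intro definable_intros num w assms)
qed

text \<open>\<open>2 * (k + 1)\<close> is the reciprocal of \<epsilon>/2 for \<epsilon> = 1/(k+1).
  The two function arguments are the reciprocal of u' = min(\<nu>/2, \<nu>2) and the value of
  \<iota>, in which 8b^2/\<nu> is the larger of the two terms.\<close>

definition bound ::
  "nat \<Rightarrow> (nat \<Rightarrow> nat) \<Rightarrow> (nat \<Rightarrow> nat) \<Rightarrow> (nat \<Rightarrow> nat) \<Rightarrow> (nat \<Rightarrow> nat) \<Rightarrow> (nat \<Rightarrow> nat) \<Rightarrow> nat \<Rightarrow>
    (nat \<Rightarrow> nat) \<Rightarrow> nat" where
  "bound b \<eta> \<tau> \<theta> \<alpha> \<gamma> k g =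
    reduced_bound b (inv_u b \<eta> \<tau> (2 * (k + 1)))
      (\<lambda>m n. max (2 * inv_nu1 b \<eta> \<tau> \<theta> \<gamma> (2 * (k + 1)) g m n) (inv_nu2 b \<eta> \<tau> (2 * (k + 1))))
      (\<lambda>m n. running_max \<alpha> (8 * b\<^sup>2 * inv_nu1 b \<eta> \<tau> \<theta> \<gamma> (2 * (k + 1)) g m n))"

lemma definable_bound:
  assumes "definable G b" and "definable G \<eta>" and "definable G \<tau>" and "definable G \<theta>"
    and "definable G \<alpha>" and "definable G \<gamma>" and "definable G k" and "definable G g"
  shows "definable G (\<lambda>c. bound (b c) (\<eta> c) (\<tau> c) (\<theta> c) (\<alpha> c) (\<gamma> c) (k c) (g c))"
proof -
  note assms2 = assms[THEN definable_fst, THEN definable_fst]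
  have q: "definable G (\<lambda>c m n.
      max (2 * inv_nu1 (b c) (\<eta> c) (\<tau> c) (\<theta> c) (\<gamma> c) (2 * (k c + 1)) (g c) m n)
        (inv_nu2 (b c) (\<eta> c) (\<tau> c) (2 * (k c + 1))))"
    by (rule definable_lam, rule definable_lam)
      (intro definable_intros definable_snd definable_fst[OF definable_snd] assms2)
  have j: "definable G (\<lambda>c m n. running_max (\<alpha> c)
      (8 * (b c)\<^sup>2 * inv_nu1 (b c) (\<eta> c) (\<tau> c) (\<theta> c) (\<gamma> c) (2 * (k c + 1)) (g c) m n))"
    by (rule definable_lam, rule definable_lam)
      (intro definable_intros definable_snd definable_fst[OF definable_snd] assms2)
  show ?thesis
    unfolding bound_def by (intro definable_intros q j assms)
qed

text \<open>After abstraction over all eight parameters the context is empty, where definability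
  means representation by a closed term.\<close>

lemma bound_T1_term:
  "\<exists>t. T1_term (TNat \<rightarrow>\<^sub>T (TNat \<rightarrow>\<^sub>T TNat) \<rightarrow>\<^sub>T (TNat \<rightarrow>\<^sub>T TNat) \<rightarrow>\<^sub>T (TNat \<rightarrow>\<^sub>T TNat) \<rightarrow>\<^sub>T
      (TNat \<rightarrow>\<^sub>T TNat) \<rightarrow>\<^sub>T (TNat \<rightarrow>\<^sub>T TNat) \<rightarrow>\<^sub>T TNat \<rightarrow>\<^sub>T (TNat \<rightarrow>\<^sub>T TNat) \<rightarrow>\<^sub>T TNat) t \<and>
    represents t bound"
proof -
  have "definable empty_ctx (\<lambda>_. bound)"
    by ((rule definable_lam)+, rule definable_bound; intro definable_snd definable_fst)
  then show ?thesis
    unfolding definable_def by (force simp: empty_ctx_def ty_of_fun_def ty_of_nat_def)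
qed

section \<open>Evaluation of the real quantities\<close>

lemma min_inverse_of_nat: "x > 0 \<Longrightarrow> y > 0 \<Longrightarrow> min (1 / real x) (1 / real y) = 1 / real (max x y)"
  by (auto simp: min_def max_def field_simps)

text \<open>At a reciprocal 1/N the ceiling in \<open>real_modulus\<close> is exactly N, so no
  rounding takes place.\<close>

lemma real_modulus_inverse:
  assumes "N > 0" and "s = 1 / real N"
  shows "real_modulus f s = 1 / real (Suc (f (N - 1)))"
  using assms by (simp add: real_modulus_def)

lemma inv_psi_pos: "A > 0 \<Longrightarrow> inv_psi b \<eta> A > 0"
  by (simp add: inv_psi_def less_max_iff_disj)

lemma half_inv_omega_pos: "b > 0 \<Longrightarrow> A > 0 \<Longrightarrow> half_inv_omega b \<tau> A > 0"
  by (simp add: half_inv_omega_def)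

lemma inv_theta'_pos: "inv_theta' \<theta> A > 0"
  by (simp add: inv_theta'_def)

lemma half_inv_nu4_pos: "b > 0 \<Longrightarrow> E > 0 \<Longrightarrow> half_inv_nu4 b \<tau> E > 0"
  by (simp add: half_inv_nu4_def less_max_iff_disj)

lemma inv_delta_pos: "inv_delta b \<tau> E > 0"
  by (simp add: inv_delta_def)

lemma inv_pe_pos: "E > 0 \<Longrightarrow> inv_pe b \<tau> E > 0"
  by (simp add: inv_pe_def less_max_iff_disj)

lemma inv_nu2_pos: "b > 0 \<Longrightarrow> E > 0 \<Longrightarrow> inv_nu2 b \<eta> \<tau> E > 0"
  by (simp add: inv_nu2_def inv_psi_pos half_inv_omega_pos inv_pe_pos)

lemma inv_u_pos: "b > 0 \<Longrightarrow> E > 0 \<Longrightarrow> inv_u b \<eta> \<tau> E > 0"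
  by (simp add: inv_u_def less_max_iff_disj inv_nu2_pos)

lemma running_max_pos: "(\<And>n. f n > 0) \<Longrightarrow> running_max f n > 0"
  by (induction n) (auto simp: running_max_0 running_max_Suc less_max_iff_disj)

lemma inv_nu1_pos: "inv_nu1 b \<eta> \<tau> \<theta> \<gamma> E g m n > 0"
  by (simp add: inv_nu1_def running_max_pos inv_psi_pos inv_theta'_pos)

lemma Min_inverse_running_max:
  "(\<And>n. f n > 0) \<Longrightarrow> Min ((\<lambda>n. 1 / real (f n)) ` {..n}) = 1 / real (running_max f n)"
proof (induction n)
  case (Suc n)
  have "Min ((\<lambda>n. 1 / real (f n)) ` {..Suc n}) =
      min (1 / real (f (Suc n))) (Min ((\<lambda>n. 1 / real (f n)) ` {..n}))"
    by (simp add: atMost_Suc)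
  also have "\<dots> = 1 / real (running_max f (Suc n))"
    unfolding Suc.IH[OF Suc.prems] running_max_Suc
    by (rule min_inverse_of_nat) (simp_all add: Suc.prems running_max_pos)
  finally show ?case .
qed (simp add: running_max_0)

lemma \<psi>_inverse:
  assumes "b > 0" and "A > 0" and "s = 1 / real A"
  shows "metastability_bound.\<psi> b (real_modulus \<eta>) s = 1 / real (inv_psi b \<eta> A)"
proof -
  define H where "H = Suc (\<eta> (2 * b * A - 1))"
  have H: "real_modulus \<eta> (s / (2 * b)) = 1 / real H"
    unfolding H_def using assms by (intro real_modulus_inverse) auto
  have "min (s / 2) (s\<^sup>2 / (72 * b) * (1 / real H)\<^sup>2) =
      min (1 / real (2 * A)) (1 / real (72 * b * A\<^sup>2 * H\<^sup>2))"
    using assms(3) by (simp add: power_divide mult_ac)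
  also have "\<dots> = 1 / real (max (2 * A) (72 * b * A\<^sup>2 * H\<^sup>2))" (is "_ = 1 / real ?X")
    using assms by (intro min_inverse_of_nat) (auto simp: H_def)
  finally have "metastability_bound.\<psi> b (real_modulus \<eta>) s =
      min ((1 / real ?X)\<^sup>2 / 4) (s\<^sup>2 / 48 * (1 / real H)\<^sup>2)"
    unfolding metastability_bound.\<psi>_def H by simp
  also have "\<dots> = min (1 / real (4 * ?X\<^sup>2)) (1 / real (48 * A\<^sup>2 * H\<^sup>2))"
    using assms(3) by (simp add: power_divide mult_ac)
  also have "\<dots> = 1 / real (max (4 * ?X\<^sup>2) (48 * A\<^sup>2 * H\<^sup>2))"
    using assms by (intro min_inverse_of_nat) (auto simp: H_def max_def)
  finally show ?thesis by (simp add: inv_psi_def H_def)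
qed

lemma \<omega>_inverse:
  assumes "b > 0" and "A > 0" and "s = 1 / real A"
  shows "metastability_bound.\<omega> b (real_modulus \<tau>) s = 1 / real (2 * half_inv_omega b \<tau> A)"
proof -
  \<comment> \<open>From A \<ge> 1 follows s \<le> 1, which lies below the cut-off at 2.\<close>
  have s: "min s 2 = s" "max (real b) 1 = b"
    using assms by (auto simp: min_def divide_le_eq)
  have "real_modulus \<tau> (s / (2 * b)) = 1 / real (Suc (\<tau> (2 * b * A - 1)))"
    using assms by (intro real_modulus_inverse) auto
  with assms(3) show ?thesis
    unfolding metastability_bound.\<omega>_def s half_inv_omega_def
    by (simp add: power_divide algebra_simps)
qed

lemma \<theta>'_inverse:
  assumes "A > 0" and "s = 1 / real A"
  shows "metastability_bound.\<theta>' (real_modulus \<theta>) s = 1 / real (inv_theta' \<theta> A)"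
proof -
  have "real_modulus \<theta> (s / 2) = 1 / real (Suc (\<theta> (2 * A - 1)))"
    using assms by (intro real_modulus_inverse) auto
  moreover have "s / 4 = 1 / real (4 * A)"
    using assms(2) by simp
  ultimately show ?thesis
    unfolding metastability_bound.\<theta>'_def inv_theta'_def
    using assms(1) by (simp only: min_inverse_of_nat zero_less_Suc mult_pos_pos zero_less_numeral)
qed

lemma \<nu>4_inverse:
  assumes "b > 0" and "E > 0"
  shows "metastability_bound.\<nu>4 b (real_modulus \<tau>) (1 / real E) = 1 / real (2 * half_inv_nu4 b \<tau> E)"
proof -
  let ?w = "half_inv_omega b \<tau> (96 * b * E\<^sup>2)"
  have w: "metastability_bound.\<omega> b (real_modulus \<tau>) ((1 / real E)\<^sup>2 / (96 * b)) = 1 / real (2 * ?w)"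
    using assms by (intro \<omega>_inverse) (auto simp: power_divide)
  have "?w > 0" using assms by (simp add: half_inv_omega_pos)
  have "metastability_bound.\<nu>4 b (real_modulus \<tau>) (1 / real E) =
      min (1 / real (9216 * b\<^sup>2 * E ^ 4)) (min (1 / real (4 * ?w\<^sup>2)) (1 / real (16 * E\<^sup>2)))"
    unfolding metastability_bound.\<nu>4_def w by (simp add: power_divide mult_ac power_mult_distrib)
  also have "min (1 / real (4 * ?w\<^sup>2)) (1 / real (16 * E\<^sup>2)) = 1 / real (max (4 * ?w\<^sup>2) (16 * E\<^sup>2))"
    using assms \<open>?w > 0\<close> by (intro min_inverse_of_nat) auto
  also have "min (1 / real (9216 * b\<^sup>2 * E ^ 4)) \<dots> =
      1 / real (max (9216 * b\<^sup>2 * E ^ 4) (max (4 * ?w\<^sup>2) (16 * E\<^sup>2)))"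
    using assms by (intro min_inverse_of_nat) (auto simp: less_max_iff_disj)
  also have "max (9216 * b\<^sup>2 * E ^ 4) (max (4 * ?w\<^sup>2) (16 * E\<^sup>2)) = 2 * half_inv_nu4 b \<tau> E"
    unfolding half_inv_nu4_def by (simp add: nat_mult_max_right mult.assoc[symmetric])
  finally show ?thesis .
qed

lemma \<delta>_inverse:
  assumes "b > 0" and "E > 0"
  shows "metastability_bound.\<delta> b (real_modulus \<tau>) (1 / real E) = 1 / real (inv_delta b \<tau> E)"
proof -
  let ?n = "half_inv_nu4 b \<tau> E"
  have n: "?n > 0" using assms by (rule half_inv_nu4_pos)
  have "metastability_bound.\<omega> b (real_modulus \<tau>) (1 / real (2 * ?n) / (3 * b)) =
      1 / real (2 * half_inv_omega b \<tau> (6 * b * ?n))"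
    using assms n by (intro \<omega>_inverse) auto
  then have "metastability_bound.\<delta> b (real_modulus \<tau>) (1 / real E) =
      min (1 / real (2 * half_inv_omega b \<tau> (6 * b * ?n) * b)) (1 / real 4)"
    unfolding metastability_bound.\<delta>_def \<nu>4_inverse[OF assms] by simp
  also have "\<dots> = 1 / real (inv_delta b \<tau> E)"
    unfolding inv_delta_def
    using assms n by (intro min_inverse_of_nat) (auto simp: half_inv_omega_pos)
  finally show ?thesis .
qed

lemma pe_inverse:
  assumes "b > 0" and "E > 0"
  shows "metastability_bound.pe b (real_modulus \<tau>) (1 / real E) = 1 / real (inv_pe b \<tau> E)"
proof -
  let ?n = "half_inv_nu4 b \<tau> E"
  have n: "?n > 0" using assms by (rule half_inv_nu4_pos)
  have "metastability_bound.pe b (real_modulus \<tau>) (1 / real E) =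
      min (1 / real (6 * ?n)) (1 / real (96 * E\<^sup>2))"
    unfolding metastability_bound.pe_def \<nu>4_inverse[OF assms] by (simp add: power_divide)
  also have "\<dots> = 1 / real (inv_pe b \<tau> E)"
    unfolding inv_pe_def
    using assms n by (intro min_inverse_of_nat) auto
  finally show ?thesis .
qed

lemma \<nu>2_inverse:
  assumes "b > 0" and "E > 0"
  shows "metastability_bound.\<nu>2 b (real_modulus \<eta>) (real_modulus \<tau>) (1 / real E) =
    1 / real (inv_nu2 b \<eta> \<tau> E)"
proof -
  let ?P = "inv_pe b \<tau> E"
  have P: "?P > 0" using assms(2) by (rule inv_pe_pos)
  have "metastability_bound.\<omega> b (real_modulus \<tau>) (1 / real ?P / (2 * b)) =
      1 / real (2 * half_inv_omega b \<tau> (2 * b * ?P))"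
    using assms P by (intro \<omega>_inverse) auto
  moreover have "metastability_bound.\<psi> b (real_modulus \<eta>)
      (1 / real (2 * half_inv_omega b \<tau> (2 * b * ?P))) =
      1 / real (inv_psi b \<eta> (2 * half_inv_omega b \<tau> (2 * b * ?P)))"
    using assms P by (intro \<psi>_inverse) (auto simp: half_inv_omega_pos)
  ultimately show ?thesis
    unfolding metastability_bound.\<nu>2_def pe_inverse[OF assms] inv_nu2_def by simp
qed

lemma u_inverse:
  assumes "b > 0" and "E > 0"
  shows "metastability_bound.u b (real_modulus \<eta>) (real_modulus \<tau>) (1 / real E) =
    1 / real (inv_u b \<eta> \<tau> E)"
proof -
  have "metastability_bound.u b (real_modulus \<eta>) (real_modulus \<tau>) (1 / real E) =
      min (1 / real (3 * half_inv_nu4 b \<tau> E * inv_delta b \<tau> E)) (1 / real (inv_nu2 b \<eta> \<tau> E))"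
    unfolding metastability_bound.u_def \<nu>4_inverse[OF assms] \<delta>_inverse[OF assms] \<nu>2_inverse[OF assms]
    by simp
  also have "\<dots> = 1 / real (inv_u b \<eta> \<tau> E)"
    unfolding inv_u_def using assms
    by (intro min_inverse_of_nat) (auto simp: half_inv_nu4_pos inv_delta_pos inv_nu2_pos)
  finally show ?thesis .
qed

lemma \<nu>1_inverse:
  assumes "b > 0" and "E > 0" and "\<And>c. \<gamma> c > 0"
  shows "metastability_bound.\<nu>1 b (real_modulus \<eta>) (real_modulus \<tau>) (real_modulus \<theta>) \<gamma> (1 / real E) g m n =
    1 / real (inv_nu1 b \<eta> \<tau> \<theta> \<gamma> E g m n)"
proof -
  let ?P = "inv_pe b \<tau> E"
  have P: "?P > 0" using assms(2) by (rule inv_pe_pos)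
  have \<theta>: "metastability_bound.\<theta>' (real_modulus \<theta>)
      (metastability_bound.\<beta> b (real_modulus \<tau>) \<gamma> (1 / real E) c) =
      1 / real (inv_theta' \<theta> (2 * b * \<gamma> c * ?P))" for c
    unfolding metastability_bound.\<beta>_def pe_inverse[OF assms(1,2)]
    using assms P by (intro \<theta>'_inverse) auto
  have "metastability_bound.\<psi> b (real_modulus \<eta>) (1 / real (inv_theta' \<theta> (2 * b * \<gamma> c * ?P))) =
      1 / real (inv_psi b \<eta> (inv_theta' \<theta> (2 * b * \<gamma> c * ?P)))" for c
    using assms P by (intro \<psi>_inverse) (auto simp: inv_theta'_pos)
  then show ?thesis
    unfolding metastability_bound.\<nu>1_def \<theta> inv_nu1_def
    by (simp add: Min_inverse_running_max inv_psi_pos inv_theta'_pos)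
qed

section \<open>Reduction of the bound\<close>

text \<open>
  The fifth component of every \<open>(G, F)\<close> is 0, so \<open>M\<close> vanishes, and nothing depends on the components
  \<open>w\<^sub>3, w\<^sub>4, w\<^sub>5\<close>, so \<open>U(\<Omega>, i)\<close> depends on its last argument only.
\<close>

definition codes :: "SN \<Rightarrow> (nat \<Rightarrow> nat) \<Rightarrow> nat \<Rightarrow> bool" where
  "codes x \<phi> k \<longleftrightarrow> (\<exists>w3 w4 w5. x = ((\<lambda>_ _ _ _. 0, \<lambda>_ _ _ m. \<phi> m, w3, w4, w5), k))"

text \<open>The first three components stay free because \<open>\<Psi>iter\<close> passes them on
  only as w3, w4, w5.\<close>

definition codes_six :: "six \<Rightarrow> nat \<Rightarrow> nat \<Rightarrow> bool" where
  "codes_six y h f \<longleftrightarrow> (\<exists>g1 g2 g3. y = (g1, g2, g3, h, 0, f))"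

lemma codes_six_components:
  assumes "codes_six y h f"
  shows "six5 y = 0 \<and> six6 y = f"
  using assms by (auto simp: codes_six_def)

lemma codes_six_sup:
  "codes_six y h f \<Longrightarrow> codes_six y' h' f' \<Longrightarrow> codes_six (sup y y') (max h h') (max f f')"
  by (auto simp: codes_six_def sup_prod_def sup_nat_def)

lemma codes_six_Xi:
  assumes "codes_six (GF (x, x', (fst y, snd y + \<xi> (x, x', y)))) h f"
  shows "codes_six (Xi \<xi> \<xi>' GF (x, x', y)) h (\<xi>' (x, x', y) + f)"
  using assms by (cases y) (auto simp: codes_six_def Xi_def Let_def)

lemma codes_add: "codes y \<chi> l \<Longrightarrow> codes (fst y, snd y + i) \<chi> (l + i)"
  by (auto simp: codes_def)

text \<open>Since \<open>W\<close> is queried at the fixed point \<open>k\<close> only, it is stationary after two steps.\<close>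

lemma W_max:
  "W (\<lambda>r y i. max (r k) (\<chi> y)) (Suc n) y = (if n = 0 then \<chi> y else max (\<chi> k) (\<chi> y))"
  by (induction n arbitrary: y) auto

text \<open>The arguments \<open>p\<close>, \<open>y\<close>, \<open>L\<close> enter \<Omega> as w3,
  w4, w5, which \<open>codes\<close> leaves free. Hence only \<open>m\<close> matters for the value,
  and by induction the pair fed to \<Omega> is always a code; this lowers the level of the recursion
  from two to one.\<close>

lemma MU_codes:
  assumes "\<And>x \<phi> k. codes x \<phi> k \<Longrightarrow> codes_six (\<Omega> x) (h \<phi> k) (f \<phi> k)"
  shows "MU \<Omega> i = ((\<lambda>_ _ _ _. 0), (\<lambda>_ _ _. rec_nat (\<lambda>_. 0) (\<lambda>_. f) i))"
proof (induction i)
  case (Suc i)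
  have "codes_six (\<Omega> ((fst (MU \<Omega> i), snd (MU \<Omega> i), p, y, L), m))
      (h (rec_nat (\<lambda>_. 0) (\<lambda>_. f) i) m) (f (rec_nat (\<lambda>_. 0) (\<lambda>_. f) i) m)" for p y L m
    by (rule assms) (simp add: codes_def Suc)
  then have "six5 (\<Omega> ((fst (MU \<Omega> i), snd (MU \<Omega> i), p, y, L), m)) = 0 \<and>
    six6 (\<Omega> ((fst (MU \<Omega> i), snd (MU \<Omega> i), p, y, L), m)) =
      f (rec_nat (\<lambda>_. 0) (\<lambda>_. f) i) m" for p y L m
    by (rule codes_six_components)
  then show ?case by simp
qed simp

section \<open>Counterfunctions and solution functionals on codes\<close>

context metastability_bound
begin

lemma J_const: "J U (\<lambda>_ _ _. k) K n = (if n = 0 then 0 else k)"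
  by (cases n) auto

lemma U1_codes: "codes (w, k) \<phi> k \<Longrightarrow> U1 w k = (\<lambda>r1 r2 r3. max (r1 k) (\<phi> r2))"
  by (auto simp: U1_def codes_def)

lemma M1_codes: "codes (w, k) \<phi> k \<Longrightarrow> M1 w k = (\<lambda>_ _ _. k)"
  by (auto simp: M1_def codes_def)

lemma U2_codes:
  "codes (w, k) \<phi> k \<Longrightarrow> codes (v, l) \<chi> l \<Longrightarrow>
    U2 w k v l = (\<lambda>r1 r2 r3. max (r1 k) (max (\<phi> r2) (\<chi> r2)))"
  by (auto simp: U2_def codes_def)

lemma M2_codes: "codes (w, k) \<phi> k \<Longrightarrow> codes (v, l) \<chi> l \<Longrightarrow> M2 w k v l = (\<lambda>_ _ _. k)"
  by (auto simp: M2_def codes_def)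

text \<open>At the point k both cases of \<open>W_max\<close> give \<open>\<chi> k\<close>, so a
  single step suffices, and b > 0 provides it.\<close>

lemma NN_diag:
  assumes "b > 0"
  shows "NN (\<lambda>r y i. max (r k) (\<chi> y)) M K k = \<chi> k"
proof -
  obtain n where "b\<^sup>2 * (K + 1) = Suc n"
    using assms gr0_implies_Suc[of "b\<^sup>2 * (K + 1)"] by auto
  then show ?thesis by (simp only: NN_def W_max) simp
qed

text \<open>Away from k the second case of \<open>W_max\<close> is needed: b > 0 and K > 0 give b^2
  (K + 1) \<ge> 2 steps.\<close>

lemma NN_max:
  assumes "b > 0" and "K > 0"
  shows "NN (\<lambda>r y i. max (r k) (\<chi> y)) M K l = max (\<chi> k) (\<chi> l)"
proof -
  obtain b' K' where "b\<^sup>2 = Suc b'" "K = Suc K'"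
    using assms gr0_implies_Suc[of "b\<^sup>2"] gr0_implies_Suc[of K] by auto
  then have "b\<^sup>2 * (K + 1) = Suc (Suc (b' * (K + 1) + K'))" by simp
  then show ?thesis by (simp only: NN_def W_max) simp
qed

lemma TT_const: "b > 0 \<Longrightarrow> TT U (\<lambda>_ _ _. k) K = k"
  by (simp add: TT_def J_const)

lemma codes_six_GF0:
  assumes "b > 0" and "codes x \<phi> k"
  shows "codes_six (GF0 x) k (\<phi> k)"
proof -
  obtain w where x: "x = (w, k)" using assms(2) by (auto simp: codes_def)
  show ?thesis
    using assms unfolding x
    by (simp add: GF0_def codes_six_def Let_def U1_codes M1_codes NN_diag TT_const)
qed

lemma codes_six_GF1:
  assumes "b > 0" and "codes y \<chi> h"
  shows "codes_six (GF1 (x, x', y)) h (\<chi> h)"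
proof -
  obtain v where y: "y = (v, h)" using assms(2) by (auto simp: codes_def)
  show ?thesis
    using assms unfolding y
    by (simp add: GF1_def codes_six_def Let_def U1_codes M1_codes NN_diag TT_const)
qed

text \<open>Positivity of u and u' makes the ceiling K positive, as \<open>NN_max\<close> requires;
  it is applied to the pointwise maximum of \<open>\<phi>\<close> and \<open>\<chi>\<close>.\<close>

lemma codes_six_GF2:
  assumes "b > 0" and "codes x \<phi> k" and "codes y \<chi> l" and "u > 0" and "u' (x, x') > 0"
  shows "codes_six (GF2 (x, x', y)) k (max4 \<phi> k \<chi> l)"
proof -
  obtain w where x: "x = (w, k)" using assms(2) by (auto simp: codes_def)
  obtain v where y: "y = (v, l)" using assms(3) by (auto simp: codes_def)
  have "nat \<lceil>4 / min u (u' (x, x'))\<rceil> > 0" using assms(4,5) by simp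
  then show ?thesis
    using assms(1-3) unfolding x y
    by (simp add: GF2_def codes_six_def Let_def U2_codes M2_codes TT_const max4_def
        NN_max[of _ k "\<lambda>y. max (\<phi> y) (\<chi> y)"])
qed

lemma ktilde_codes: "b > 0 \<Longrightarrow> codes x \<phi> k \<Longrightarrow> ktilde x = k + \<phi> k"
  using codes_six_components[OF codes_six_GF0[of x \<phi> k]] by (auto simp: ktilde_def codes_def)

text \<open>The passage from \<Omega> to its description \<open>(h, f)\<close> on codes. Since
  \<open>Mbar\<close> vanishes, so does \<open>TT\<close>; thus \<open>\<Psi>0\<close> has number 0,
  and the maximum with it leaves every later number unchanged.\<close>

lemma codes_\<Psi>:
  assumes "\<And>x \<phi> k. codes x \<phi> k \<Longrightarrow> codes_six (\<Omega> x) (h \<phi> k) (f \<phi> k)"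
  shows "codes (\<Psi> l \<Omega>) (iter_fun b l f) (iter_num b l f h)"
proof -
  have MU: "MU \<Omega> i = ((\<lambda>_ _ _ _. 0), (\<lambda>_ _ _. rec_nat (\<lambda>_. 0) (\<lambda>_. f) i))" for i
    using assms by (rule MU_codes)
  have "Mbar l \<Omega> = (\<lambda>_ _ _. 0)"
    unfolding Mbar_def MU by simp
  then have TT: "TT (Ubar l \<Omega>) (Mbar l \<Omega>) K = 0" for K
    by (simp add: TT_def J_const)
  have iter: "rec_nat (\<lambda>_. 0) (\<lambda>_. f) (I l) = iter_fun b l f"
    by (simp add: iter_fun_def I_def)
  have "codes (\<Psi>iter l \<Omega> i) (iter_fun b l f) (rec_nat 0 (\<lambda>_. h (iter_fun b l f)) i)" for i
  proof (induction i)
    case 0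
    show ?case by (simp add: codes_def \<Psi>0_def MU TT iter)
  next
    case (Suc i)
    from assms[OF this] show ?case
      by (auto simp: codes_six_def codes_def \<Psi>0_def MU TT iter sup_prod_def sup_nat_def)
  qed
  then show ?thesis by (simp add: \<Psi>_def iter_num_def I_def)
qed

end

text \<open>Isolates all that the reduction has to know about the reals: \<open>u\<close>,
  \<open>\<nu>2\<close> and the values of \<open>\<nu>1\<close> are reciprocals of positive
  integers.\<close>

locale inverse_metastability_bound = metastability_bound +
  fixes a c :: nat and d :: "nat \<Rightarrow> nat \<Rightarrow> nat"
  assumes b: "b > 0"
    and u: "u = 1 / real a" and a: "a > 0"
    and \<nu>2: "\<nu>2 = 1 / real c" and c: "c > 0"
    and \<nu>1: "\<And>m n. \<nu>1 m n = 1 / real (d m n)" and d: "\<And>m n. d m n > 0"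
begin

text \<open>The reciprocal of u' and, in \<open>j\<close>, the value of \<iota>, as functions of the
  two values of \<open>ktilde\<close>.\<close>

definition q :: "nat \<Rightarrow> nat \<Rightarrow> nat" where
  "q m n = max (2 * d m n) c"

definition j :: "nat \<Rightarrow> nat \<Rightarrow> nat" where
  "j m n = running_max \<alpha> (8 * b\<^sup>2 * d m n)"

lemma u'_codes:
  assumes "codes x \<phi> k" and "codes x' \<phi>' k'"
  shows "u' (x, x') = 1 / real (q (k + \<phi> k) (k' + \<phi>' k'))"
proof -
  have "u' (x, x') = min (1 / real (2 * d (k + \<phi> k) (k' + \<phi>' k'))) (1 / real c)"
    using assms b by (simp add: u'_def \<nu>_def \<nu>1 \<nu>2 ktilde_codes)
  then show ?thesis
    using d c by (simp only: q_def min_inverse_of_nat mult_pos_pos zero_less_numeral)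
qed

lemma q_pos: "q m n > 0"
  using c by (simp add: q_def less_max_iff_disj)

text \<open>As \<open>\<nu> \<le> 1\<close>, the square root in \<open>\<iota>\<close> never determines the maximum.\<close>

lemma \<iota>_codes:
  assumes "codes x \<phi> k" and "codes x' \<phi>' k'"
  shows "\<iota> (x, x') = j (k + \<phi> k) (k' + \<phi>' k')"
proof -
  define V where "V = d (k + \<phi> k) (k' + \<phi>' k')"
  have \<nu>: "\<nu> (x, x') = 1 / real V"
    using assms b by (simp add: V_def \<nu>_def \<nu>1 ktilde_codes)
  have "V \<ge> 1" using d[of "k + \<phi> k" "k' + \<phi>' k'"] by (simp add: V_def)
  then have "1 \<le> real V" by simp
  then have "sqrt V \<le> V"
    by (intro real_le_lsqrt) (auto simp: power2_eq_square)
  moreover have "2 * real b \<le> 8 * (real b)\<^sup>2"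
    using b by (simp add: power2_eq_square)
  ultimately have "2 * b * sqrt V \<le> 8 * (real b)\<^sup>2 * V"
    by (intro mult_mono) auto
  then have "max (2 * b / sqrt (\<nu> (x, x'))) (8 * (real b)\<^sup>2 / \<nu> (x, x')) = real (8 * b\<^sup>2 * V)"
    unfolding \<nu> by (simp add: real_sqrt_divide)
  then have "nat \<lceil>max (2 * b / sqrt (\<nu> (x, x'))) (8 * (real b)\<^sup>2 / \<nu> (x, x'))\<rceil> = 8 * b\<^sup>2 * V"
    by (simp only: ceiling_of_nat nat_int)
  then show ?thesis unfolding \<iota>_def j_def V_def by simp
qed

lemma codes_six_Xi_GF2:
  assumes "codes x \<phi> k" and "codes x' \<phi>' k'" and "codes y \<chi> l"
  shows "codes_six (Xi \<xi> \<xi>' GF2 (x, x', y)) k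
    (\<xi>' (x, x', y) + max4 \<phi> k \<chi> (l + \<xi> (x, x', y)))"
  using assms b a q_pos
  by (intro codes_six_Xi codes_six_GF2 codes_add) (auto simp: u u'_codes)

text \<open>On codes, u' and \<iota> depend on x and x' only through m and n, so with x and x' fixed
  the counterfunction has a description on codes of y and \<open>codes_\<Psi>\<close> applies. The
  shifts \<open>\<xi>2\<close> and \<open>\<xi>2'\<close> return k and k'.\<close>

lemma codes_av:
  assumes "codes x \<phi> k" and "codes x' \<phi>' k'"
  defines "m \<equiv> k + \<phi> k" and "n \<equiv> k' + \<phi>' k'"
  shows "codes (av (x, x')) (iter_fun b (q m n) (fv (j m n) \<phi> k k))
      (iter_num b (q m n) (fv (j m n) \<phi> k k) (hv (j m n) k))"
    and "codes (av' (x, x')) (iter_fun b (q m n) (fv (j m n) \<phi> k k'))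
      (iter_num b (q m n) (fv (j m n) \<phi> k k') (hv (j m n) k))"
proof -
  have q: "nat \<lceil>1 / u' (x, x')\<rceil> = q m n"
    using u'_codes[OF assms(1,2)] by (simp add: m_def n_def)
  have \<xi>: "\<xi>1 (x, x', y) = j m n" "\<xi>2 (x, x', y) = k" "\<xi>2' (x, x', y) = k'" for y
    using \<iota>_codes[OF assms(1,2)] assms(1,2)
    by (auto simp: \<xi>1_def \<xi>2_def \<xi>2'_def m_def n_def codes_def split_beta)
  have 1: "codes_six (Xi \<xi>1 \<xi>1 GF1 (x, x', y)) (h + j m n) (j m n + \<chi> (h + j m n))"
    if "codes y \<chi> h" for y \<chi> h
    using codes_six_Xi[of GF1 x x' y \<xi>1 _ _ \<xi>1] codes_six_GF1[OF b codes_add[OF that]]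
    by (simp add: \<xi>)
  note 2 = codes_six_Xi_GF2[OF assms(1,2)]
  have "codes_six (GFv (x, x', y)) (hv (j m n) k \<chi> h) (fv (j m n) \<phi> k k \<chi> h)"
    and "codes_six (GFv' (x, x', y)) (hv (j m n) k \<chi> h) (fv (j m n) \<phi> k k' \<chi> h)"
    if "codes y \<chi> h" for y \<chi> h
    unfolding GFv_def GFv'_def hv_def fv_def
    using codes_six_sup[OF 1[OF that] 2[OF that, of \<xi>2 \<xi>2]]
      codes_six_sup[OF 1[OF that] 2[OF that, of \<xi>2' \<xi>2']] by (simp_all add: \<xi>)
  from this[THEN codes_\<Psi>]
  show "codes (av (x, x')) (iter_fun b (q m n) (fv (j m n) \<phi> k k))
      (iter_num b (q m n) (fv (j m n) \<phi> k k) (hv (j m n) k))"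
    and "codes (av' (x, x')) (iter_fun b (q m n) (fv (j m n) \<phi> k k'))
      (iter_num b (q m n) (fv (j m n) \<phi> k k') (hv (j m n) k))"
    unfolding av_def av'_def by (simp_all add: q)
qed

lemma ceiling_inverse_u: "nat \<lceil>1 / u\<rceil> = a"
  by (simp add: u)

lemma codes_six_Xi_v_bound:
  assumes "codes x \<phi> k" and "codes x' \<phi>' k'"
  shows "codes_six (Xi \<xi>2 \<xi>0 GF2 (x, x', av (x, x'))) k (v_bound b q j \<phi> k \<phi>' k' k)"
    and "codes_six (Xi \<xi>2' \<xi>0 GF2 (x, x', av' (x, x'))) k (v_bound b q j \<phi> k \<phi>' k' k')"
  using codes_six_Xi_GF2[OF assms codes_av(1)[OF assms], of \<xi>2 \<xi>0]
    codes_six_Xi_GF2[OF assms codes_av(2)[OF assms], of \<xi>2' \<xi>0]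
    codes_av[OF assms] assms
  by (auto simp: v_bound_def Let_def codes_def \<xi>0_def \<xi>2_def \<xi>2'_def split_beta)

text \<open>In the fourth component \<open>max k' k\<close>, the number k' comes from
  \<open>GF0\<close> at x' and k from \<open>GF2\<close>, which returns the number of its first
  argument.\<close>

lemma codes_aw':
  assumes "codes x \<phi> k"
  shows "codes (aw' x) (w'_fun b a q j \<phi> k) (w'_num b a q j \<phi> k)"
proof -
  have "codes_six (GFw' (x, x')) (max k' k) (fw' b q j \<phi> k \<phi>' k')" if "codes x' \<phi>' k'" for x' \<phi>' k'
    unfolding GFw'_def fw'_def
    using codes_six_sup[OF codes_six_GF0[OF b that] codes_six_Xi_v_bound(2)[OF assms that]] by simp
  from codes_\<Psi>[of "\<lambda>s. GFw' (x, s)", OF this] show ?thesis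
    unfolding aw'_def w'_fun_def w'_num_def ceiling_inverse_u .
qed

lemma \<Theta>'_eq_reduced_bound: "\<Theta>' = reduced_bound b a q j"
proof -
  have "codes_six (GFw x) k (fw b a q j \<phi> k)" if "codes x \<phi> k" for x \<phi> k
    unfolding GFw_def fw_def
    using codes_six_sup[OF codes_six_GF0[OF b that] codes_six_Xi_v_bound(1)[OF that codes_aw'[OF that]]]
    by simp
  \<comment> \<open>The code of the outermost \<open>\<Psi>\<close> yields that of
    \<open>aw'\<close> at it, and this yields the value of \<open>ktilde\<close>.\<close>
  from codes_\<Psi>[of GFw "\<lambda>\<phi> k. k", OF this, THEN codes_aw', THEN ktilde_codes[OF b]]
  show ?thesis
    unfolding \<Theta>'_def ceiling_inverse_u reduced_bound_def Let_def by simp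
qed

end

text \<open>With \<open>E\<close> the reciprocal of \<epsilon>/2, positivity of b and \<gamma>
  supplies the three reciprocals for the locale, and its \<open>q\<close> and \<open>j\<close> are
  the functions in \<open>bound\<close>.\<close>

lemma \<Theta>_eq_bound:
  assumes "b > 0" and "\<And>n. \<gamma> n > 0"
  shows "\<Theta> b (real_modulus \<eta>) (real_modulus \<tau>) (real_modulus \<theta>) \<alpha> \<gamma> (1 / (real k + 1)) g =
    bound b \<eta> \<tau> \<theta> \<alpha> \<gamma> k g"
proof -
  define E where "E = 2 * (k + 1)"
  have E: "E > 0" "1 / (real k + 1) / 2 = 1 / real E" by (simp_all add: E_def field_simps)
  interpret inverse_metastability_bound b "real_modulus \<eta>" "real_modulus \<tau>" "real_modulus \<theta>" \<alpha> \<gamma>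
    "1 / real E" g "inv_u b \<eta> \<tau> E" "inv_nu2 b \<eta> \<tau> E" "inv_nu1 b \<eta> \<tau> \<theta> \<gamma> E g"
    using assms E(1)
    by unfold_locales (simp_all add: u_inverse \<nu>1_inverse \<nu>2_inverse inv_u_pos inv_nu1_pos inv_nu2_pos)
  show ?thesis
    unfolding \<Theta>_def E(2) \<Theta>'_eq_reduced_bound bound_def q_def[abs_def] j_def[abs_def] E_def[symmetric] ..
qed

theorem corollary6p2:
  "\<exists>t. in_T1 t \<and> closed_trm t \<and>
     t :\<^sub>T TNat \<rightarrow>\<^sub>T (TNat \<rightarrow>\<^sub>T TNat) \<rightarrow>\<^sub>T (TNat \<rightarrow>\<^sub>T TNat) \<rightarrow>\<^sub>T (TNat \<rightarrow>\<^sub>T TNat) \<rightarrow>\<^sub>T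
          (TNat \<rightarrow>\<^sub>T TNat) \<rightarrow>\<^sub>T (TNat \<rightarrow>\<^sub>T TNat) \<rightarrow>\<^sub>T TNat \<rightarrow>\<^sub>T (TNat \<rightarrow>\<^sub>T TNat) \<rightarrow>\<^sub>T TNat \<and>
     (\<forall>(b::nat) (\<eta>::nat \<Rightarrow> nat) (\<tau>::nat \<Rightarrow> nat) (\<theta>::nat \<Rightarrow> nat) (\<alpha>::nat \<Rightarrow> nat) (\<gamma>::nat \<Rightarrow> nat)
        (k::nat) (g::nat \<Rightarrow> nat).
        b \<ge> 1 \<longrightarrow> (\<forall>n. \<gamma> n \<ge> 1) \<longrightarrow>
        t \<cdot> numeral_trm b \<cdot> Fct \<eta> \<cdot> Fct \<tau> \<cdot> Fct \<theta> \<cdot> Fct \<alpha> \<cdot> Fct \<gamma> \<cdot> numeral_trm k \<cdot> Fct g \<Down>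
          \<Theta> b (real_modulus \<eta>) (real_modulus \<tau>) (real_modulus \<theta>) \<alpha> \<gamma> (1 / (real k + 1)) g)"
proof -
  obtain t where t: "T1_term (TNat \<rightarrow>\<^sub>T (TNat \<rightarrow>\<^sub>T TNat) \<rightarrow>\<^sub>T (TNat \<rightarrow>\<^sub>T TNat) \<rightarrow>\<^sub>T (TNat \<rightarrow>\<^sub>T TNat) \<rightarrow>\<^sub>T
      (TNat \<rightarrow>\<^sub>T TNat) \<rightarrow>\<^sub>T (TNat \<rightarrow>\<^sub>T TNat) \<rightarrow>\<^sub>T TNat \<rightarrow>\<^sub>T (TNat \<rightarrow>\<^sub>T TNat) \<rightarrow>\<^sub>T TNat) t"
    "represents t bound"
    using bound_T1_term by blast
  have "represents (t \<cdot> numeral_trm b \<cdot> Fct \<eta> \<cdot> Fct \<tau> \<cdot> Fct \<theta> \<cdot> Fct \<alpha> \<cdot> Fct \<gamma> \<cdot> numeral_trm k \<cdot> Fct g)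
      (bound b \<eta> \<tau> \<theta> \<alpha> \<gamma> k g)" for b \<eta> \<tau> \<theta> \<alpha> \<gamma> k g
    by (rule t(2)[THEN represents_App, OF represents_numeral_trm,
          THEN represents_App, OF represents_Fct, THEN represents_App, OF represents_Fct,
          THEN represents_App, OF represents_Fct, THEN represents_App, OF represents_Fct,
          THEN represents_App, OF represents_Fct, THEN represents_App, OF represents_numeral_trm,
          THEN represents_App, OF represents_Fct])
  then have "t \<cdot> numeral_trm b \<cdot> Fct \<eta> \<cdot> Fct \<tau> \<cdot> Fct \<theta> \<cdot> Fct \<alpha> \<cdot> Fct \<gamma> \<cdot> numeral_trm k \<cdot> Fct g \<Down>
      bound b \<eta> \<tau> \<theta> \<alpha> \<gamma> k g" for b \<eta> \<tau> \<theta> \<alpha> \<gamma> k g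
    unfolding represents_nat_def .
  with t(1) show ?thesis
    unfolding T1_term_def by (intro exI[of _ t]) (simp add: \<Theta>_eq_bound Suc_le_eq)
qed

end
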